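(* There exist a compact metrizable Hausdorff space $X$ and a uniform algebra $B$ on $X$ such that there exists a nonzero bounded point derivation on $B$ (at some point of the maximal ideal space $\mathfrak{M}_B$), but $B$ has no nontrivial Gleason parts.
   Context: A uniform algebra on a compact Hausdorff space $X$ is a subalgebra of $C(X)$ (continuous complex-valued functions, supremum norm) that is closed, contains the constant functions, and separates the points of $X$. The maximal ideal space $\mathfrak{M}_B$ is the set of nonzero multiplicative linear functionals on $B$ with the Gelfand (weak-* ) topology. For $\phi\in\mathfrak{M}_B$, a point derivation on $B$ at $\phi$ is a linear functional $\psi$ on $B$ (not assumed continuous) with $\psi(fg)=\psi(f)\phi(g)+\phi(f)\psi(g)$ for all $f,g\in B$; it is bounded if it is continuous as a linear functional on $B$. The Gleason parts for $B$ are the equivalence classes in $\mathfrak{M}_B$ under the equivalence relation $\phi\sim\psi$ if and only if $\|\phi-\psi\|<2$ (norm of the dual space $B^*$). A Gleason part is nontrivial if it contains more than one point. *)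

theory Defs
  imports "HOL-Analysis.Analysis"
begin

(* Elements of C(X) are represented by functions that are extensional on topspace X, as in
   the library's metric space cfunspace of bounded continuous maps with the supremum
   distance.  Functionals on B are represented by functions extensional on B.  In both
   cases this makes HOL equality coincide with equality of the mathematical objects. *)

definition cfun_const :: "'a topology \<Rightarrow> complex \<Rightarrow> 'a \<Rightarrow> complex" where
  "cfun_const X c = (\<lambda>x\<in>topspace X. c)"

definition cfun_add :: "'a topology \<Rightarrow> ('a \<Rightarrow> complex) \<Rightarrow> ('a \<Rightarrow> complex) \<Rightarrow> 'a \<Rightarrow> complex" where
  "cfun_add X f g = (\<lambda>x\<in>topspace X. f x + g x)"

definition cfun_mult :: "'a topology \<Rightarrow> ('a \<Rightarrow> complex) \<Rightarrow> ('a \<Rightarrow> complex) \<Rightarrow> 'a \<Rightarrow> complex" where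
  "cfun_mult X f g = (\<lambda>x\<in>topspace X. f x * g x)"

definition cfun_scale :: "'a topology \<Rightarrow> complex \<Rightarrow> ('a \<Rightarrow> complex) \<Rightarrow> 'a \<Rightarrow> complex" where
  "cfun_scale X c f = (\<lambda>x\<in>topspace X. c * f x)"

abbreviation cfun_metric :: "'a topology \<Rightarrow> ('a \<Rightarrow> complex) metric" where
  "cfun_metric X \<equiv> cfunspace X euclidean_metric"

definition sup_norm :: "'a topology \<Rightarrow> ('a \<Rightarrow> complex) \<Rightarrow> real" where
  "sup_norm X f = mdist (cfun_metric X) f (cfun_const X 0)"

lemma mspace_cfun_metric:
  assumes "compact_space X"
  shows "mspace (cfun_metric X) =
           {f \<in> extensional (topspace X). continuous_map X (euclidean :: complex topology) f}"
  using assms by (subst compactin_mspace_cfunspace) (auto simp: compact_space_def)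

lemma sup_norm_le_iff:
  assumes "compact_space X" "f \<in> mspace (cfun_metric X)" "0 \<le> a"
  shows "sup_norm X f \<le> a \<longleftrightarrow> (\<forall>x\<in>topspace X. cmod (f x) \<le> a)"
proof
  have z: "cfun_const X 0 \<in> mspace (cfun_metric X)"
    by (subst mspace_cfun_metric[OF assms(1)]) (auto simp: cfun_const_def)
  show "\<forall>x\<in>topspace X. cmod (f x) \<le> a" if "sup_norm X f \<le> a"
    using mdist_cfunspace_imp_mdist_le[OF assms(2) z] that
    by (fastforce simp: sup_norm_def cfun_const_def)
  show "sup_norm X f \<le> a" if "\<forall>x\<in>topspace X. cmod (f x) \<le> a"
    unfolding sup_norm_def using that assms(3)
    by (intro mdist_cfunspace_le) (auto simp: cfun_const_def)
qed

definition uniform_algebra :: "'a topology \<Rightarrow> ('a \<Rightarrow> complex) set \<Rightarrow> bool" where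
  "uniform_algebra X B \<longleftrightarrow>
     compact_space X \<and> Hausdorff_space X \<and>
     B \<subseteq> mspace (cfun_metric X) \<and>
     (\<forall>f\<in>B. \<forall>g\<in>B. cfun_add X f g \<in> B) \<and>
     (\<forall>f\<in>B. \<forall>g\<in>B. cfun_mult X f g \<in> B) \<and>
     (\<forall>c. \<forall>f\<in>B. cfun_scale X c f \<in> B) \<and>
     closedin (mtopology_of (cfun_metric X)) B \<and>
     (\<forall>c. cfun_const X c \<in> B) \<and>
     (\<forall>x\<in>topspace X. \<forall>y\<in>topspace X. x \<noteq> y \<longrightarrow> (\<exists>f\<in>B. f x \<noteq> f y))"

definition linear_functional ::
    "'a topology \<Rightarrow> ('a \<Rightarrow> complex) set \<Rightarrow> (('a \<Rightarrow> complex) \<Rightarrow> complex) \<Rightarrow> bool" where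
  "linear_functional X B L \<longleftrightarrow>
     L \<in> extensional B \<and>
     (\<forall>f\<in>B. \<forall>g\<in>B. L (cfun_add X f g) = L f + L g) \<and>
     (\<forall>c. \<forall>f\<in>B. L (cfun_scale X c f) = c * L f)"

definition characters ::
    "'a topology \<Rightarrow> ('a \<Rightarrow> complex) set \<Rightarrow> (('a \<Rightarrow> complex) \<Rightarrow> complex) set" where
  "characters X B =
     {\<phi>. linear_functional X B \<phi> \<and>
         (\<forall>f\<in>B. \<forall>g\<in>B. \<phi> (cfun_mult X f g) = \<phi> f * \<phi> g) \<and>
         (\<exists>f\<in>B. \<phi> f \<noteq> 0)}"

(* The Gelfand (weak-star) topology is the topology of pointwise convergence on B. *)

definition maximal_ideal_space ::
    "'a topology \<Rightarrow> ('a \<Rightarrow> complex) set \<Rightarrow> (('a \<Rightarrow> complex) \<Rightarrow> complex) topology" where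
  "maximal_ideal_space X B =
     subtopology (product_topology (\<lambda>_. euclidean) B) (characters X B)"

lemma topspace_maximal_ideal_space [simp]:
  "topspace (maximal_ideal_space X B) = characters X B"
  by (auto simp: maximal_ideal_space_def characters_def linear_functional_def PiE_def)

definition point_derivation ::
    "'a topology \<Rightarrow> ('a \<Rightarrow> complex) set \<Rightarrow> (('a \<Rightarrow> complex) \<Rightarrow> complex)
      \<Rightarrow> (('a \<Rightarrow> complex) \<Rightarrow> complex) \<Rightarrow> bool" where
  "point_derivation X B \<phi> \<psi> \<longleftrightarrow>
     linear_functional X B \<psi> \<and>
     (\<forall>f\<in>B. \<forall>g\<in>B. \<psi> (cfun_mult X f g) = \<psi> f * \<phi> g + \<phi> f * \<psi> g)"

definition bounded_point_derivation ::
    "'a topology \<Rightarrow> ('a \<Rightarrow> complex) set \<Rightarrow> (('a \<Rightarrow> complex) \<Rightarrow> complex)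
      \<Rightarrow> (('a \<Rightarrow> complex) \<Rightarrow> complex) \<Rightarrow> bool" where
  "bounded_point_derivation X B \<phi> \<psi> \<longleftrightarrow>
     point_derivation X B \<phi> \<psi> \<and>
     continuous_map (subtopology (mtopology_of (cfun_metric X)) B) euclidean \<psi>"

(* Extended-real valued, so that the supremum is meaningful without first knowing that the
   functional is bounded. *)

definition dual_norm ::
    "'a topology \<Rightarrow> ('a \<Rightarrow> complex) set \<Rightarrow> (('a \<Rightarrow> complex) \<Rightarrow> complex) \<Rightarrow> ereal" where
  "dual_norm X B L = (SUP f\<in>{f\<in>B. sup_norm X f \<le> 1}. ereal (cmod (L f)))"

definition gleason_rel ::
    "'a topology \<Rightarrow> ('a \<Rightarrow> complex) set
      \<Rightarrow> ((('a \<Rightarrow> complex) \<Rightarrow> complex) \<times> (('a \<Rightarrow> complex) \<Rightarrow> complex)) set" where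
  "gleason_rel X B =
     {(\<phi>, \<psi>). \<phi> \<in> topspace (maximal_ideal_space X B) \<and>
              \<psi> \<in> topspace (maximal_ideal_space X B) \<and>
              dual_norm X B (\<lambda>f\<in>B. \<phi> f - \<psi> f) < 2}"

definition gleason_parts ::
    "'a topology \<Rightarrow> ('a \<Rightarrow> complex) set \<Rightarrow> (('a \<Rightarrow> complex) \<Rightarrow> complex) set set" where
  "gleason_parts X B = topspace (maximal_ideal_space X B) // gleason_rel X B"

definition nontrivial_part :: "(('a \<Rightarrow> complex) \<Rightarrow> complex) set \<Rightarrow> bool" where
  "nontrivial_part P \<longleftrightarrow> (\<exists>\<phi>\<in>P. \<exists>\<psi>\<in>P. \<phi> \<noteq> \<psi>)"

end

theory Submission
  imports Defs "HOL-Complex_Analysis.Cauchy_Integral_Formula" "HOL-Library.Nat_Bijection"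
begin

text \<open>
  If all functions in an algebra have roots of every order, then no Gleason part is nontrivial: a
  function of norm at most $1$ that vanishes at one character and not at another has roots that
  still vanish at the first while their values at the second tend to $1$ in modulus, and a Moebius
  transform of the disc then spreads $0$ and $1$ to nearly antipodal values (\<open>dual_norm_ge_2\<close>).  A
  derivation $\psi$ at a point $x_0$ obstructs taking all roots, since $f = g^m$ with $m \ge 2$ and
  $g(x_0) = 0$ forces $\psi(f) = 0$.  The idea is to start from the disc algebra with
  $\psi(f) = f'(0)$ and to adjoin roots only of functions $q$ with $q(x_0) = 0$ and $\psi(q) = 0$.

  Concretely, let $K \subseteq \mathbf{C}^{\mathbf{N}}$ consist of the sequences with
  $|z_0| \le 1$ in which every later coordinate is a root
  \[ z_{n+1}^m = (z_i - d)\,z_j^2, \qquad i, j \le n, \]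
  where $(i, j, d, m)$ runs through all indices, all $d$ in a dense sequence, and all $m \ge 1$ as
  $n$ varies.  The algebra $B$ is the uniform closure of the polynomials in the coordinates, the
  point $x_0$ is the origin, and $\psi$ is the partial derivative with respect to $z_0$ there.

  Boundedness of $\psi$ is the heart of the matter (\<open>axis_deriv_le\<close>).  Averaging a polynomial over the
  $m$-th roots of unity acting on its last coordinate does not increase its supremum over $K$.  It
  replaces $z_{n+1}^m$ by the radicand, and the radicand has zero value and zero derivative at the
  origin, so the derivative is unchanged (\<open>root_average\<close>).  Repeating this removes all
  coordinates but $z_0$, and Cauchy's inequality on the unit disc finishes the estimate.

  The roots adjoined are still enough to make the parts trivial.  Every character of $B$ is
  evaluation at a point of $K$, because its values on the coordinates satisfy the same equations
  (\<open>character_is_evaluation\<close>).  Of two distinct points $x$, $y$ at least one differs from the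
  origin; say $y_j \neq 0$ and $x_i \neq y_i$.  Then $(z_i - d)\,z_j^2$ with $d$ close to $x_i$ is
  small at $x$ and not at $y$, and its roots of all orders are coordinates
  (\<open>separating_sequence\<close>).
\<close>

section \<open>Uniform closures of algebras of continuous functions\<close>

definition function_algebra :: "'a topology \<Rightarrow> ('a \<Rightarrow> complex) set \<Rightarrow> bool" where
  "function_algebra X A \<longleftrightarrow>
     A \<subseteq> mspace (cfun_metric X) \<and>
     (\<forall>f\<in>A. \<forall>g\<in>A. cfun_add X f g \<in> A) \<and>
     (\<forall>f\<in>A. \<forall>g\<in>A. cfun_mult X f g \<in> A) \<and>
     (\<forall>c. cfun_const X c \<in> A)"

definition uniform_closure :: "'a topology \<Rightarrow> ('a \<Rightarrow> complex) set \<Rightarrow> ('a \<Rightarrow> complex) set" where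
  "uniform_closure X A = mtopology_of (cfun_metric X) closure_of A"

text \<open>Membership in the metric space of continuous functions is unfolded through
  \<open>mspace_cfun_metric\<close>, whose right-hand side has no boundedness condition when the space is
  compact.\<close>

declare mspace_cfunspace [simp del]

lemma cfun_scale_eq_mult: "cfun_scale X c f = cfun_mult X (cfun_const X c) f"
  by (auto simp: cfun_scale_def cfun_mult_def cfun_const_def)

lemma function_algebra_scale:
  "function_algebra X A \<Longrightarrow> f \<in> A \<Longrightarrow> cfun_scale X c f \<in> A"
  by (simp add: cfun_scale_eq_mult function_algebra_def)

lemma uniform_algebra_imp_function_algebra:
  "uniform_algebra X B \<Longrightarrow> function_algebra X B"
  by (simp add: uniform_algebra_def function_algebra_def)

lemma mdist_cfun_le_iff:
  assumes "compact_space X" "f \<in> mspace (cfun_metric X)" "g \<in> mspace (cfun_metric X)" "0 \<le> a"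
  shows "mdist (cfun_metric X) f g \<le> a \<longleftrightarrow> (\<forall>x\<in>topspace X. dist (f x) (g x) \<le> a)"
proof
  show "\<forall>x\<in>topspace X. dist (f x) (g x) \<le> a" if "mdist (cfun_metric X) f g \<le> a"
    using mdist_cfunspace_imp_mdist_le[OF assms(2,3)] that by fastforce
  show "mdist (cfun_metric X) f g \<le> a" if "\<forall>x\<in>topspace X. dist (f x) (g x) \<le> a"
    using that assms(4) by (intro mdist_cfunspace_le) auto
qed

lemma uniform_limit_of_error_bound:
  fixes e :: "nat \<Rightarrow> real"
  assumes "\<And>n x. x \<in> S \<Longrightarrow> dist (a n x) (f x) \<le> e n" "e \<longlonglongrightarrow> 0"
  shows "uniform_limit S a f sequentially"
proof (rule uniform_limitI)
  fix d :: real assume "d > 0"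
  then have "\<forall>\<^sub>F n in sequentially. e n < d"
    using assms(2) by (simp add: order_tendstoD)
  then show "\<forall>\<^sub>F n in sequentially. \<forall>x\<in>S. dist (a n x) (f x) < d"
    by eventually_elim (use assms(1) le_less_trans in blast)
qed

text \<open>All later arguments pass from a function algebra to its closure through approximating
  sequences, so the closure is described by uniform limits instead of metric balls.\<close>

lemma uniform_closure_iff:
  assumes X: "compact_space X" and A: "A \<subseteq> mspace (cfun_metric X)"
  shows "f \<in> uniform_closure X A \<longleftrightarrow> f \<in> mspace (cfun_metric X) \<and>
           (\<exists>a. (\<forall>k. a k \<in> A) \<and> uniform_limit (topspace X) a f sequentially)"
proof -
  interpret Metric_space "mspace (cfun_metric X)" "mdist (cfun_metric X)"
    by blast
  have *: "f \<in> uniform_closure X A \<longleftrightarrow> f \<in> mspace (cfun_metric X) \<and>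
             (\<forall>r>0. \<exists>a\<in>A. \<forall>x\<in>topspace X. dist (f x) (a x) \<le> r)"
    unfolding uniform_closure_def mtopology_of_def metric_closure_of_alt
  proof (safe, goal_cases)
    case (1 r)
    then obtain a where "a \<in> A" "a \<in> mcball f r"
      by blast
    with 1 show ?case
      by (intro bexI[of _ a]) (auto simp: mdist_cfun_le_iff[OF X])
  next
    case (2 r)
    then obtain a where a: "a \<in> A" "\<forall>x\<in>topspace X. dist (f x) (a x) \<le> r"
      by blast
    with 2 A show ?case
      by (intro bexI[of _ a]) (auto simp: mdist_cfun_le_iff[OF X])
  qed
  show ?thesis
  proof safe
    assume "f \<in> uniform_closure X A"
    with * have "\<forall>k. \<exists>a\<in>A. \<forall>x\<in>topspace X. dist (f x) (a x) \<le> 1 / real (Suc k)"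
      by auto
    then obtain a where a: "\<And>k. a k \<in> A"
        "\<And>k x. x \<in> topspace X \<Longrightarrow> dist (f x) (a k x) \<le> 1 / real (Suc k)"
      by metis
    have "uniform_limit (topspace X) a f sequentially"
      using a(2) lim_1_over_n[THEN LIMSEQ_Suc] by (intro uniform_limit_of_error_bound) (auto simp: dist_commute)
    with a(1) show "\<exists>a. (\<forall>k. a k \<in> A) \<and> uniform_limit (topspace X) a f sequentially"
      by blast
  next
    assume f: "f \<in> mspace (cfun_metric X)"
    fix a assume a: "\<forall>k. a k \<in> A" "uniform_limit (topspace X) a f sequentially"
    have "\<exists>b\<in>A. \<forall>x\<in>topspace X. dist (f x) (b x) \<le> r" if r: "r > 0" for r
    proof -
      obtain N where "\<forall>x\<in>topspace X. dist (a N x) (f x) < r"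
        using uniform_limitD[OF a(2) r] by (auto simp: eventually_sequentially)
      then show ?thesis
        using a(1) by (intro bexI[of _ "a N"]) (auto simp: dist_commute intro: less_imp_le)
    qed
    with f * show "f \<in> uniform_closure X A"
      by blast
  qed (use * in blast)
qed

lemma subset_uniform_closure:
  "compact_space X \<Longrightarrow> A \<subseteq> mspace (cfun_metric X) \<Longrightarrow> A \<subseteq> uniform_closure X A"
  unfolding uniform_closure_def by (intro closure_of_subset) simp

lemma uniform_closure_of_uniform_algebra:
  "uniform_algebra X B \<Longrightarrow> uniform_closure X B = B"
  by (simp add: uniform_closure_def uniform_algebra_def closure_of_closedin)

lemma bounded_cfun:
  assumes "compact_space X" "f \<in> mspace (cfun_metric X)"
  shows "bounded (f ` topspace X)"
proof -
  have "continuous_map X euclidean f"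
    using assms by (simp add: mspace_cfun_metric)
  then have "compactin euclidean (f ` topspace X)"
    using assms(1) unfolding compact_space_def by (rule image_compactin[rotated])
  then show ?thesis
    by (simp add: compact_imp_bounded)
qed

lemma cfun_add_mspace:
  assumes "compact_space X" "f \<in> mspace (cfun_metric X)" "g \<in> mspace (cfun_metric X)"
  shows "cfun_add X f g \<in> mspace (cfun_metric X)"
  using assms unfolding mspace_cfun_metric[OF assms(1)]
  by (auto simp: cfun_add_def intro: continuous_map_eq[OF continuous_map_add])

lemma cfun_mult_mspace:
  assumes "compact_space X" "f \<in> mspace (cfun_metric X)" "g \<in> mspace (cfun_metric X)"
  shows "cfun_mult X f g \<in> mspace (cfun_metric X)"
proof -
  have "continuous_map X euclidean (\<lambda>x. f x * g x)"
    using assms unfolding mspace_cfun_metric[OF assms(1)] continuous_map_atin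
    by (auto intro: tendsto_mult)
  then show ?thesis
    unfolding mspace_cfun_metric[OF assms(1)]
    by (auto simp: cfun_mult_def intro: continuous_map_eq)
qed

lemma uniform_limit_cfun_add:
  assumes "uniform_limit (topspace X) a f F" "uniform_limit (topspace X) b g F"
  shows "uniform_limit (topspace X) (\<lambda>k. cfun_add X (a k) (b k)) (cfun_add X f g) F"
  using uniform_limit_add[OF assms]
  by (rule uniform_limit_cong'[THEN iffD1, rotated -1]) (auto simp: cfun_add_def)

lemma uniform_limit_cfun_mult:
  assumes "compact_space X" "f \<in> mspace (cfun_metric X)" "g \<in> mspace (cfun_metric X)"
  assumes "uniform_limit (topspace X) a f F" "uniform_limit (topspace X) b g F"
  shows "uniform_limit (topspace X) (\<lambda>k. cfun_mult X (a k) (b k)) (cfun_mult X f g) F"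
  using uniform_lim_mult[OF assms(4,5)] bounded_cfun assms(1-3)
  by (intro uniform_limit_cong'[THEN iffD1, OF _ _ uniform_lim_mult[OF assms(4,5)]])
     (auto simp: cfun_mult_def)

lemma uniform_algebra_uniform_closure:
  assumes X: "compact_space X" "Hausdorff_space X" and A: "function_algebra X A"
    and sep: "\<And>x y. x \<in> topspace X \<Longrightarrow> y \<in> topspace X \<Longrightarrow> x \<noteq> y \<Longrightarrow> \<exists>f\<in>A. f x \<noteq> f y"
  shows "uniform_algebra X (uniform_closure X A)"
proof -
  have AX: "A \<subseteq> mspace (cfun_metric X)"
    and A_add: "\<And>f g. f \<in> A \<Longrightarrow> g \<in> A \<Longrightarrow> cfun_add X f g \<in> A"
    and A_mult: "\<And>f g. f \<in> A \<Longrightarrow> g \<in> A \<Longrightarrow> cfun_mult X f g \<in> A"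
    and A_const: "\<And>c. cfun_const X c \<in> A"
    using A by (simp_all add: function_algebra_def)
  note iff = uniform_closure_iff[OF X(1) AX]
  have sub: "A \<subseteq> uniform_closure X A"
    using subset_uniform_closure[OF X(1) AX] .
  have add: "cfun_add X f g \<in> uniform_closure X A"
    if "f \<in> uniform_closure X A" "g \<in> uniform_closure X A" for f g
  proof -
    from that obtain a b where ab: "\<And>k. a k \<in> A" "\<And>k. b k \<in> A"
      and fg: "f \<in> mspace (cfun_metric X)" "g \<in> mspace (cfun_metric X)"
      and lim: "uniform_limit (topspace X) a f sequentially"
        "uniform_limit (topspace X) b g sequentially"
      unfolding iff by blast
    show ?thesis
      unfolding iff
      using ab fg A_add uniform_limit_cfun_add[OF lim]
      by (intro conjI exI[of _ "\<lambda>k. cfun_add X (a k) (b k)"] cfun_add_mspace[OF X(1)]) auto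
  qed
  have mult: "cfun_mult X f g \<in> uniform_closure X A"
    if "f \<in> uniform_closure X A" "g \<in> uniform_closure X A" for f g
  proof -
    from that obtain a b where ab: "\<And>k. a k \<in> A" "\<And>k. b k \<in> A"
      and fg: "f \<in> mspace (cfun_metric X)" "g \<in> mspace (cfun_metric X)"
      and lim: "uniform_limit (topspace X) a f sequentially"
        "uniform_limit (topspace X) b g sequentially"
      unfolding iff by blast
    show ?thesis
      unfolding iff
      using ab fg A_mult uniform_limit_cfun_mult[OF X(1) fg lim]
      by (intro conjI exI[of _ "\<lambda>k. cfun_mult X (a k) (b k)"] cfun_mult_mspace[OF X(1)]) auto
  qed
  have "closedin (mtopology_of (cfun_metric X)) (uniform_closure X A)"
    by (simp add: uniform_closure_def)
  moreover have "uniform_closure X A \<subseteq> mspace (cfun_metric X)"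
    using iff by blast
  moreover have "cfun_scale X c f \<in> uniform_closure X A" if "f \<in> uniform_closure X A" for c f
    using that mult sub A_const by (auto simp: cfun_scale_eq_mult)
  ultimately show ?thesis
    unfolding uniform_algebra_def
  proof (intro conjI ballI impI allI)
    fix x y assume "x \<in> topspace X" "y \<in> topspace X" "x \<noteq> y"
    then show "\<exists>f\<in>uniform_closure X A. f x \<noteq> f y"
      using sep sub by blast
  qed (use X add mult sub A_const in auto)
qed

section \<open>The transform $f/(1-f)$ and the norm of a character\<close>

text \<open>The sum of the geometric series $f + f^2 + \cdots$ is the fixed point of $h \mapsto f + fh$,
  and iterating this contraction from $0$ stays inside the algebra.  The transform serves twice: it
  bounds characters, and it produces the Moebius transforms that separate Gleason parts.\<close>

lemma uniform_algebra_geometric: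
  assumes B: "uniform_algebra X B" and f: "f \<in> B" and c: "c < 1"
    and le: "\<And>x. x \<in> topspace X \<Longrightarrow> cmod (f x) \<le> c"
  shows "(\<lambda>x\<in>topspace X. f x / (1 - f x)) \<in> B"
proof -
  define h where "h = (\<lambda>x\<in>topspace X. f x / (1 - f x))"
  define s where "s n = ((\<lambda>u. cfun_add X f (cfun_mult X f u)) ^^ n) (cfun_const X 0)" for n
  have X: "compact_space X" and BX: "B \<subseteq> mspace (cfun_metric X)"
    using B by (auto simp: uniform_algebra_def)
  have sB: "s n \<in> B" for n
    using B f by (induction n) (auto simp: s_def uniform_algebra_def)
  have fx: "continuous_map X euclidean f"
    using f BX by (auto simp: mspace_cfun_metric[OF X])
  have "continuous_map X (top_of_set (cball 0 c)) f"
    using fx le by (auto simp: continuous_map_in_subtopology)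
  moreover have "continuous_map (top_of_set (cball 0 c)) euclidean (\<lambda>z::complex. z / (1 - z))"
    using c by (auto intro!: continuous_intros)
  ultimately have "continuous_map X euclidean ((\<lambda>z. z / (1 - z)) \<circ> f)"
    by (rule continuous_map_compose)
  then have hX: "h \<in> mspace (cfun_metric X)"
    by (auto simp: mspace_cfun_metric[OF X] h_def intro: continuous_map_eq)
  have err: "dist (s n x) (h x) \<le> c ^ n * (c / (1 - c))" if x: "x \<in> topspace X" for n x
  proof (induction n)
    case 0
    have "1 - c \<le> cmod (1 - f x)"
      using le[OF x] norm_triangle_ineq2[of 1 "f x"] by simp
    moreover have "0 \<le> c"
      using le[OF x] norm_ge_zero order_trans by blast
    ultimately have "cmod (f x) / cmod (1 - f x) \<le> c / (1 - c)"
      using le[OF x] c by (intro frac_le) auto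
    then show ?case
      using x by (simp add: s_def h_def cfun_const_def dist_norm norm_divide)
  next
    case (Suc n)
    have ne: "1 - f x \<noteq> 0"
      using le[OF x] c by auto
    have "s (Suc n) x - h x = f x * (s n x - h x)"
      using x ne by (simp add: s_def h_def cfun_add_def cfun_mult_def field_simps)
    then have "dist (s (Suc n) x) (h x) = cmod (f x) * dist (s n x) (h x)"
      by (simp add: dist_norm norm_mult)
    also have "\<dots> \<le> c * (c ^ n * (c / (1 - c)))"
      using le[OF x] Suc by (intro mult_mono) (auto intro: order_trans[OF norm_ge_zero])
    finally show ?case by simp
  qed
  have "uniform_limit (topspace X) s h sequentially"
  proof (cases "topspace X = {}")
    case False
    then have "0 \<le> c"
      using le norm_ge_zero order_trans by blast
    then have "(\<lambda>n. c ^ n * (c / (1 - c))) \<longlonglongrightarrow> 0"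
      using c by (intro tendsto_mult_left_zero LIMSEQ_power_zero) auto
    then show ?thesis
      using err by (intro uniform_limit_of_error_bound) auto
  qed (auto intro!: uniform_limitI)
  then have "h \<in> uniform_closure X B"
    unfolding uniform_closure_iff[OF X BX] using hX sB by blast
  then show ?thesis
    using uniform_closure_of_uniform_algebra[OF B] by (simp add: h_def)
qed

text \<open>If $|\phi(f)|$ exceeded the norm of $f$, then after scaling $\phi(f) = 1$ with
  $\|f\| < 1$, and $h = f/(1-f)$ would satisfy $h = f + fh$, hence $\phi(h) = 1 + \phi(h)$.\<close>

lemma character_norm_le:
  assumes B: "uniform_algebra X B" and phi: "\<phi> \<in> characters X B" and f: "f \<in> B"
    and le: "\<And>x. x \<in> topspace X \<Longrightarrow> cmod (f x) \<le> c" and c: "0 \<le> c"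
  shows "cmod (\<phi> f) \<le> c"
proof (rule ccontr)
  assume neg: "\<not> cmod (\<phi> f) \<le> c"
  define g where "g = cfun_scale X (1 / \<phi> f) f"
  define h where "h = (\<lambda>x\<in>topspace X. g x / (1 - g x))"
  have nz: "\<phi> f \<noteq> 0"
    using neg c by auto
  have gB: "g \<in> B"
    using B f by (simp add: g_def uniform_algebra_def)
  have "c / cmod (\<phi> f) < 1"
    using neg nz c by (simp add: divide_simps)
  moreover have g_le: "cmod (g x) \<le> c / cmod (\<phi> f)" if "x \<in> topspace X" for x
    using le[OF that] nz that by (simp add: g_def cfun_scale_def norm_divide divide_right_mono)
  ultimately have hB: "h \<in> B"
    unfolding h_def using uniform_algebra_geometric[OF B gB] by blast
  have "h = cfun_add X g (cfun_mult X g h)"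
  proof
    fix x
    have "g x \<noteq> 1" if "x \<in> topspace X"
      using g_le[OF that] \<open>c / cmod (\<phi> f) < 1\<close> by auto
    then show "h x = cfun_add X g (cfun_mult X g h) x"
      by (auto simp: h_def cfun_add_def cfun_mult_def field_simps)
  qed
  moreover have "\<phi> (cfun_add X g (cfun_mult X g h)) = \<phi> g + \<phi> g * \<phi> h"
    using phi B gB hB by (simp add: characters_def linear_functional_def uniform_algebra_def)
  moreover have "\<phi> g = 1"
    using phi f nz by (simp add: g_def characters_def linear_functional_def)
  ultimately show False
    by simp
qed

lemma character_add:
  "\<phi> \<in> characters X B \<Longrightarrow> f \<in> B \<Longrightarrow> g \<in> B \<Longrightarrow> \<phi> (cfun_add X f g) = \<phi> f + \<phi> g"
  and character_mult:
  "\<phi> \<in> characters X B \<Longrightarrow> f \<in> B \<Longrightarrow> g \<in> B \<Longrightarrow> \<phi> (cfun_mult X f g) = \<phi> f * \<phi> g"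
  and character_scale:
  "\<phi> \<in> characters X B \<Longrightarrow> f \<in> B \<Longrightarrow> \<phi> (cfun_scale X c f) = c * \<phi> f"
  by (simp_all add: characters_def linear_functional_def)

lemma character_const:
  assumes "uniform_algebra X B" "\<phi> \<in> characters X B"
  shows "\<phi> (cfun_const X c) = c"
proof -
  obtain f where f: "f \<in> B" "\<phi> f \<noteq> 0"
    using assms(2) by (auto simp: characters_def)
  have cB: "cfun_const X c \<in> B"
    using assms(1) by (simp add: uniform_algebra_def)
  have "\<phi> (cfun_const X c) * \<phi> f = \<phi> (cfun_scale X c f)"
    unfolding cfun_scale_eq_mult by (rule character_mult[OF assms(2) cB f(1), symmetric])
  also have "\<dots> = c * \<phi> f"
    by (rule character_scale[OF assms(2) f(1)])
  finally show ?thesis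
    using f(2) by simp
qed

lemma evaluation_character:
  assumes "uniform_algebra X B" "x \<in> topspace X"
  shows "(\<lambda>f\<in>B. f x) \<in> characters X B"
proof -
  have "cfun_const X 1 \<in> B" "cfun_const X 1 x \<noteq> 0"
    using assms by (simp_all add: uniform_algebra_def cfun_const_def)
  then have "\<exists>f\<in>B. f x \<noteq> 0" by blast
  then show ?thesis
    using assms unfolding characters_def linear_functional_def uniform_algebra_def
    by (simp add: cfun_add_def cfun_mult_def cfun_scale_def)
qed

lemma character_geometric:
  assumes B: "uniform_algebra X B" and phi: "\<phi> \<in> characters X B" and f: "f \<in> B" and c: "0 \<le> c" "c < 1"
    and le: "\<And>x. x \<in> topspace X \<Longrightarrow> cmod (f x) \<le> c"
  shows "\<phi> (\<lambda>x\<in>topspace X. f x / (1 - f x)) = \<phi> f / (1 - \<phi> f)"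
proof -
  define h where "h = (\<lambda>x\<in>topspace X. f x / (1 - f x))"
  have hB: "h \<in> B"
    unfolding h_def by (rule uniform_algebra_geometric[OF B f c(2) le])
  have h_eq: "h = cfun_add X f (cfun_mult X f h)"
  proof
    fix x
    have "f x \<noteq> 1" if "x \<in> topspace X"
      using le[OF that] c by auto
    then show "h x = cfun_add X f (cfun_mult X f h) x"
      by (auto simp: h_def cfun_add_def cfun_mult_def field_simps)
  qed
  have "cfun_mult X f h \<in> B"
    using B f hB by (simp add: uniform_algebra_def)
  then have "\<phi> (cfun_add X f (cfun_mult X f h)) = \<phi> f + \<phi> f * \<phi> h"
    by (simp only: character_add[OF phi f] character_mult[OF phi f hB])
  then have "\<phi> h = \<phi> f + \<phi> f * \<phi> h"
    unfolding h_eq[symmetric] .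
  then have eq: "\<phi> h - \<phi> f * \<phi> h = \<phi> f"
    by (rule diff_eq_eq[THEN iffD2])
  have "\<phi> h * (1 - \<phi> f) = \<phi> h - \<phi> f * \<phi> h"
    by (simp add: algebra_simps)
  then have prod: "\<phi> h * (1 - \<phi> f) = \<phi> f"
    using eq by (rule trans)
  have "1 - \<phi> f \<noteq> 0"
    using character_norm_le[OF B phi f le c(1)] c(2) by auto
  from nonzero_eq_divide_eq[THEN iffD2, OF this prod] show ?thesis
    unfolding h_def .
qed

section \<open>Gleason parts\<close>

lemma no_nontrivial_part:
  assumes "\<And>\<phi> \<psi>. \<phi> \<in> characters X B \<Longrightarrow> \<psi> \<in> characters X B \<Longrightarrow> \<phi> \<noteq> \<psi> \<Longrightarrow>
             2 \<le> dual_norm X B (\<lambda>f\<in>B. \<phi> f - \<psi> f)"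
  shows "\<not> (\<exists>P \<in> gleason_parts X B. nontrivial_part P)"
proof -
  have "gleason_rel X B \<subseteq> Id"
    using assms by (fastforce simp: gleason_rel_def dest: leD)
  then show ?thesis
    unfolding gleason_parts_def nontrivial_part_def quotient_def by blast
qed

lemma moebius_bound:
  fixes z :: complex and r :: real
  assumes "0 < r" "r < 1" "cmod z \<le> 1"
  shows "cmod ((z - r) / (1 - r * z)) \<le> 1"
proof -
  have "(cmod (1 - r * z))\<^sup>2 - (cmod (z - r))\<^sup>2 = (1 - r\<^sup>2) * (1 - (cmod z)\<^sup>2)"
    unfolding cmod_power2 by (simp add: power2_eq_square algebra_simps)
  moreover have "0 \<le> (1 - r\<^sup>2) * (1 - (cmod z)\<^sup>2)"
    using assms by (intro mult_nonneg_nonneg) (simp_all add: power_le_one)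
  ultimately have "(cmod (z - r))\<^sup>2 \<le> (cmod (1 - r * z))\<^sup>2"
    by linarith
  then have "cmod (z - r) \<le> cmod (1 - r * z)"
    by (rule power2_le_imp_le) simp
  then show ?thesis
    by (simp add: norm_divide divide_le_eq_1)
qed

text \<open>For $r$ close to $1$ the Moebius transform $z \mapsto (z-r)/(1-rz)$ of the unit disc moves
  the pair $0, 1$ to the almost antipodal pair $-r, 1$.  Applied to a function $g$ of norm at most $1$
  it stays in the algebra, because it gives $-r + \frac{1-r^2}{r} \cdot \frac{f}{1-f}$ with
  $f = rg$.\<close>

lemma dual_norm_ge_2:
  assumes B: "uniform_algebra X B" and phi: "\<phi> \<in> characters X B" and psi: "\<psi> \<in> characters X B"
    and g: "\<And>k. g k \<in> B" "\<And>k x. x \<in> topspace X \<Longrightarrow> cmod (g k x) \<le> 1"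
    and lim0: "(\<lambda>k. \<phi> (g k)) \<longlonglongrightarrow> 0" and lim1: "(\<lambda>k. cmod (\<psi> (g k))) \<longlonglongrightarrow> 1"
  shows "2 \<le> dual_norm X B (\<lambda>f\<in>B. \<phi> f - \<psi> f)"
proof -
  have X: "compact_space X" and BX: "B \<subseteq> mspace (cfun_metric X)"
    using B by (auto simp: uniform_algebra_def)
  note B_scale = function_algebra_scale[OF uniform_algebra_imp_function_algebra[OF B]]
  have B_add: "\<And>f g. f \<in> B \<Longrightarrow> g \<in> B \<Longrightarrow> cfun_add X f g \<in> B" and B_const: "\<And>c. cfun_const X c \<in> B"
    using B by (simp_all add: uniform_algebra_def)
  \<comment> \<open>This factor has modulus at most $1$ and turns $\psi(g_k)$ into its absolute value.\<close>
  define u where "u k = cnj (sgn (\<psi> (g k)))" for k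
  define G where "G k = cfun_scale X (u k) (g k)" for k
  have u1: "cmod (u k) \<le> 1" for k
    by (simp add: u_def norm_sgn)
  have GB: "G k \<in> B" for k
    unfolding G_def by (rule B_scale[OF g(1)])
  have G1: "cmod (G k x) \<le> 1" if "x \<in> topspace X" for k x
    using u1[of k] g(2)[OF that, of k] that by (simp add: G_def cfun_scale_def norm_mult mult_le_one)
  have phiG: "(\<lambda>k. \<phi> (G k)) \<longlonglongrightarrow> 0"
  proof (rule Lim_null_comparison[OF _ tendsto_norm_zero[OF lim0]])
    show "\<forall>\<^sub>F k in sequentially. norm (\<phi> (G k)) \<le> norm (\<phi> (g k))"
      using u1 by (auto simp: G_def character_scale[OF phi g(1)] norm_mult mult_left_le_one_le)
  qed
  have psi_G: "\<psi> (G k) = of_real (cmod (\<psi> (g k)))" for k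
  proof -
    have "\<psi> (G k) = cnj (sgn (\<psi> (g k))) * \<psi> (g k)"
      by (simp add: G_def u_def character_scale[OF psi g(1)])
    also have "\<dots> = (\<psi> (g k) * cnj (\<psi> (g k))) / of_real (cmod (\<psi> (g k)))"
      by (simp add: sgn_eq)
    also have "\<dots> = of_real (cmod (\<psi> (g k)))"
      unfolding complex_norm_square[symmetric] by (simp add: power2_eq_square)
    finally show ?thesis .
  qed
  have "(\<lambda>k. complex_of_real (cmod (\<psi> (g k)))) \<longlonglongrightarrow> complex_of_real 1"
    by (rule tendsto_of_real[OF lim1])
  then have psiG: "(\<lambda>k. \<psi> (G k)) \<longlonglongrightarrow> 1"
    unfolding psi_G of_real_1 .
  have *: "ereal (1 + r) \<le> dual_norm X B (\<lambda>f\<in>B. \<phi> f - \<psi> f)" if r: "0 < r" "r < 1" for r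
  proof -
    define T where "T z = (z - complex_of_real r) / (1 - of_real r * z)" for z
    define c where "c = complex_of_real ((1 - r\<^sup>2) / r)"
    have T: "T z = - of_real r + c * (of_real r * z / (1 - of_real r * z))" if "cmod z \<le> 1" for z
    proof -
      have "cmod (of_real r * z) \<le> r"
        using that r by (simp add: norm_mult mult_left_le)
      then have ne: "1 - of_real r * z \<noteq> 0"
        using r by auto
      have "c * of_real r = 1 - of_real r * of_real r"
        using r by (simp add: c_def power2_eq_square)
      then have "c * (of_real r * z / (1 - of_real r * z)) = (1 - of_real r * of_real r) * z / (1 - of_real r * z)"
        by (metis mult.assoc times_divide_eq_right)
      moreover have "z - of_real r = - of_real r * (1 - of_real r * z) + (1 - of_real r * of_real r) * z"
        by (simp add: algebra_simps)
      then have "T z = - of_real r + (1 - of_real r * of_real r) * z / (1 - of_real r * z)"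
        unfolding T_def using ne by (metis add_divide_distrib nonzero_mult_div_cancel_right)
      ultimately show ?thesis
        by (simp only:)
    qed
    define F where "F k = cfun_scale X (of_real r) (G k)" for k
    define H where "H k = cfun_add X (cfun_const X (- of_real r))
      (cfun_scale X c (\<lambda>x\<in>topspace X. F k x / (1 - F k x)))" for k
    have FB: "F k \<in> B" for k
      unfolding F_def by (rule B_scale[OF GB])
    have F1: "cmod (F k x) \<le> r" if "x \<in> topspace X" for k x
      using G1[OF that, of k] r that by (simp add: F_def cfun_scale_def norm_mult mult_left_le)
    note geo = uniform_algebra_geometric[OF B FB r(2) F1]
    have HB: "H k \<in> B" for k
      unfolding H_def by (intro B_add B_const B_scale geo)
    have "H k x = T (G k x)" if "x \<in> topspace X" for k x
      using that T[OF G1[OF that]]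
      by (simp add: H_def F_def cfun_add_def cfun_scale_def cfun_const_def)
    then have "cmod (H k x) \<le> 1" if "x \<in> topspace X" for k x
      using moebius_bound[OF r G1[OF that]] that by (simp add: T_def)
    then have H1: "sup_norm X (H k) \<le> 1" for k
      using sup_norm_le_iff[OF X, of "H k" 1] HB BX by auto
    have chiH: "\<theta> (H k) = T (\<theta> (G k))" if th: "\<theta> \<in> characters X B" for \<theta> k
    proof -
      have "\<theta> (H k) = - of_real r + c * (\<theta> (F k) / (1 - \<theta> (F k)))"
        unfolding H_def
        using r by (simp add: character_add[OF th B_const B_scale[OF geo]] character_const[OF B th]
            character_scale[OF th geo] character_geometric[OF B th FB _ _ F1])
      also have "\<theta> (F k) = of_real r * \<theta> (G k)"
        by (simp add: F_def character_scale[OF th GB])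
      finally show ?thesis
        using T[OF character_norm_le[OF B th GB G1]] by simp
    qed
    have le: "ereal (cmod (T (\<phi> (G k)) - T (\<psi> (G k)))) \<le> dual_norm X B (\<lambda>f\<in>B. \<phi> f - \<psi> f)" for k
      unfolding dual_norm_def
      using HB[of k] H1[of k] chiH[OF phi] chiH[OF psi] by (intro SUP_upper2[of "H k"]) auto
    have "(\<lambda>k. cmod (T (\<phi> (G k)) - T (\<psi> (G k)))) \<longlonglongrightarrow> cmod (T 0 - T 1)"
      unfolding T_def using r by (intro tendsto_intros phiG psiG) simp_all
    moreover have "T 0 = - of_real r" "T 1 = 1"
      using r by (simp_all add: T_def)
    then have "T 0 - T 1 = - complex_of_real (1 + r)"
      by simp
    then have "cmod (T 0 - T 1) = 1 + r"
      using r by (simp only: norm_minus_cancel norm_of_real)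
    ultimately have "(\<lambda>k. ereal (cmod (T (\<phi> (G k)) - T (\<psi> (G k))))) \<longlonglongrightarrow> ereal (1 + r)"
      by simp
    then show ?thesis
      by (rule LIMSEQ_le_const2) (use le in blast)
  qed
  have "(\<lambda>n. 1 + (1 - 1 / real (Suc (Suc n)))) \<longlonglongrightarrow> 1 + (1 - 0)"
    by (intro tendsto_intros LIMSEQ_Suc[OF LIMSEQ_Suc[OF lim_1_over_n]])
  then have lim: "(\<lambda>n. ereal (1 + (1 - 1 / real (Suc (Suc n))))) \<longlonglongrightarrow> ereal 2"
    by simp
  have "ereal (1 + (1 - 1 / real (Suc (Suc n)))) \<le> dual_norm X B (\<lambda>f\<in>B. \<phi> f - \<psi> f)" for n
    by (rule *) (auto simp: field_simps)
  then have "ereal 2 \<le> dual_norm X B (\<lambda>f\<in>B. \<phi> f - \<psi> f)"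
    by (intro LIMSEQ_le_const2[OF lim]) blast
  then show ?thesis by simp
qed

section \<open>Extending bounded derivations to the closure\<close>

text \<open>A derivation bounded by the supremum norm is Lipschitz, so along any uniformly convergent
  sequence its values converge, with a limit that depends only on the limit function.  The product
  rule survives because evaluation at the point is itself continuous.\<close>

lemma extend_point_derivation:
  assumes X: "compact_space X" and A: "function_algebra X A"
    and add: "\<And>f g. f \<in> A \<Longrightarrow> g \<in> A \<Longrightarrow> \<delta> (cfun_add X f g) = \<delta> f + \<delta> g"
    and scale: "\<And>c f. f \<in> A \<Longrightarrow> \<delta> (cfun_scale X c f) = c * \<delta> f"
    and mult: "\<And>f g. f \<in> A \<Longrightarrow> g \<in> A \<Longrightarrow> \<delta> (cfun_mult X f g) = \<delta> f * g x + f x * \<delta> g"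
    and bound: "\<And>f c. f \<in> A \<Longrightarrow> (\<And>y. y \<in> topspace X \<Longrightarrow> cmod (f y) \<le> c) \<Longrightarrow> cmod (\<delta> f) \<le> c"
    and x: "x \<in> topspace X"
  shows "\<exists>\<psi>. bounded_point_derivation X (uniform_closure X A) (\<lambda>f\<in>uniform_closure X A. f x) \<psi> \<and>
             (\<forall>f\<in>A. \<psi> f = \<delta> f)"
proof -
  define B where "B = uniform_closure X A"
  have AX: "A \<subseteq> mspace (cfun_metric X)" and A_add: "\<And>f g. f \<in> A \<Longrightarrow> g \<in> A \<Longrightarrow> cfun_add X f g \<in> A"
    and A_mult: "\<And>f g. f \<in> A \<Longrightarrow> g \<in> A \<Longrightarrow> cfun_mult X f g \<in> A"
    and A_const: "\<And>c. cfun_const X c \<in> A"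
    using A by (simp_all add: function_algebra_def)
  note A_scale = function_algebra_scale[OF A]
  have lip: "dist (\<delta> f) (\<delta> g) \<le> c"
    if fg: "f \<in> A" "g \<in> A" and c: "\<And>y. y \<in> topspace X \<Longrightarrow> dist (f y) (g y) \<le> c" for f g c
  proof -
    have "cmod (\<delta> (cfun_add X f (cfun_scale X (-1) g))) \<le> c"
      using fg c by (intro bound A_add A_scale) (auto simp: cfun_add_def cfun_scale_def dist_norm)
    then show ?thesis
      using fg by (simp add: add scale A_scale dist_norm)
  qed
  have iff: "f \<in> B \<longleftrightarrow> f \<in> mspace (cfun_metric X) \<and>
           (\<exists>a. (\<forall>k. a k \<in> A) \<and> uniform_limit (topspace X) a f sequentially)" for f
    unfolding B_def by (rule uniform_closure_iff[OF X AX])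
  \<comment> \<open>Approximating sequences of two functions have asymptotically no larger distance.\<close>
  have close: "\<exists>N. \<forall>m\<ge>N. \<forall>n\<ge>N. dist (\<delta> (a m)) (\<delta> (b n)) \<le> c + e"
    if a: "\<And>k. a k \<in> A" "uniform_limit (topspace X) a f sequentially"
      and b: "\<And>k. b k \<in> A" "uniform_limit (topspace X) b g sequentially"
      and c: "\<And>y. y \<in> topspace X \<Longrightarrow> dist (f y) (g y) \<le> c" and e: "e > 0" for a b f g c e
  proof -
    from e have e2: "e / 2 > 0" by simp
    obtain N1 where N1: "\<And>m y. m \<ge> N1 \<Longrightarrow> y \<in> topspace X \<Longrightarrow> dist (a m y) (f y) < e / 2"
      using uniform_limitD[OF a(2) e2] unfolding eventually_sequentially by blast
    obtain N2 where N2: "\<And>m y. m \<ge> N2 \<Longrightarrow> y \<in> topspace X \<Longrightarrow> dist (b m y) (g y) < e / 2"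
      using uniform_limitD[OF b(2) e2] unfolding eventually_sequentially by blast
    have "dist (\<delta> (a m)) (\<delta> (b n)) \<le> c + e" if mn: "m \<ge> max N1 N2" "n \<ge> max N1 N2" for m n
    proof (rule lip[OF a(1) b(1)])
      fix y assume y: "y \<in> topspace X"
      have "dist (a m y) (b n y) \<le> dist (a m y) (f y) + dist (f y) (g y) + dist (b n y) (g y)"
        using dist_triangle[of "a m y" "b n y" "f y"] dist_triangle[of "f y" "b n y" "g y"]
        by (simp add: dist_commute)
      then show "dist (a m y) (b n y) \<le> c + e"
        using N1[of m y] N2[of n y] c[OF y] mn y by simp
    qed
    then show ?thesis by blast
  qed
  have "\<exists>l. \<forall>a. (\<forall>k. a k \<in> A) \<longrightarrow> uniform_limit (topspace X) a f sequentially \<longrightarrow>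
          (\<lambda>k. \<delta> (a k)) \<longlonglongrightarrow> l" if f: "f \<in> B" for f
  proof -
    obtain s where s_A: "\<forall>k. s k \<in> A" and s_lim: "uniform_limit (topspace X) s f sequentially"
      using f unfolding iff by blast
    note s = s_A[rule_format] s_lim
    have "Cauchy (\<lambda>k. \<delta> (s k))"
    proof (rule metric_CauchyI)
      fix e :: real assume "e > 0"
      then obtain N where "\<forall>m\<ge>N. \<forall>n\<ge>N. dist (\<delta> (s m)) (\<delta> (s n)) \<le> 0 + e / 2"
        using close[OF s s, of 0 "e / 2"] by auto
      with \<open>e > 0\<close> show "\<exists>M. \<forall>m\<ge>M. \<forall>n\<ge>M. dist (\<delta> (s m)) (\<delta> (s n)) < e"
        by (intro exI[of _ N]) fastforce
    qed
    then obtain l where l: "(\<lambda>k. \<delta> (s k)) \<longlonglongrightarrow> l"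
      by (auto simp: Cauchy_convergent_iff convergent_def)
    have "(\<lambda>k. \<delta> (a k)) \<longlonglongrightarrow> l"
      if a: "\<forall>k. a k \<in> A" "uniform_limit (topspace X) a f sequentially" for a
    proof (rule Lim_transform2[OF l], rule metric_LIMSEQ_I)
      fix e :: real assume "e > 0"
      then obtain N where "\<forall>m\<ge>N. \<forall>n\<ge>N. dist (\<delta> (s m)) (\<delta> (a n)) \<le> 0 + e / 2"
        using close[OF s _ a(2), of 0 "e / 2"] a(1) by auto
      with \<open>e > 0\<close> show "\<exists>N. \<forall>n\<ge>N. dist (\<delta> (s n) - \<delta> (a n)) 0 < e"
        by (intro exI[of _ N]) (fastforce simp: dist_norm)
    qed
    then show ?thesis by blast
  qed
  then have "\<exists>l. \<forall>f\<in>B. \<forall>a. (\<forall>k. a k \<in> A) \<longrightarrow>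
      uniform_limit (topspace X) a f sequentially \<longrightarrow> (\<lambda>k. \<delta> (a k)) \<longlonglongrightarrow> l f"
    by (intro bchoice) blast
  then obtain l where l: "\<And>f a. f \<in> B \<Longrightarrow> (\<forall>k. a k \<in> A) \<Longrightarrow>
      uniform_limit (topspace X) a f sequentially \<Longrightarrow> (\<lambda>k. \<delta> (a k)) \<longlonglongrightarrow> l f"
    by blast
  have B_add: "cfun_add X f g \<in> B" and l_add: "l (cfun_add X f g) = l f + l g"
    and B_mult: "cfun_mult X f g \<in> B" and l_mult: "l (cfun_mult X f g) = l f * g x + f x * l g"
    if fg: "f \<in> B" "g \<in> B" for f g
  proof -
    obtain a where a: "\<forall>k. a k \<in> A" "uniform_limit (topspace X) a f sequentially"
      using fg(1) unfolding iff by blast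
    obtain b where b: "\<forall>k. b k \<in> A" "uniform_limit (topspace X) b g sequentially"
      using fg(2) unfolding iff by blast
    have X_fg: "f \<in> mspace (cfun_metric X)" "g \<in> mspace (cfun_metric X)"
      using fg unfolding iff by auto
    note lims = l[OF fg(1) a] l[OF fg(2) b] tendsto_uniform_limitI[OF a(2) x] tendsto_uniform_limitI[OF b(2) x]
    have ab: "\<forall>k. cfun_add X (a k) (b k) \<in> A" "\<forall>k. cfun_mult X (a k) (b k) \<in> A"
      using a(1) b(1) A_add A_mult by auto
    show 1: "cfun_add X f g \<in> B"
      unfolding iff using cfun_add_mspace[OF X X_fg] uniform_limit_cfun_add[OF a(2) b(2)] ab(1)
      by (intro conjI exI[of _ "\<lambda>k. cfun_add X (a k) (b k)"])
    show 2: "cfun_mult X f g \<in> B"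
      unfolding iff using cfun_mult_mspace[OF X X_fg] uniform_limit_cfun_mult[OF X X_fg a(2) b(2)] ab(2)
      by (intro conjI exI[of _ "\<lambda>k. cfun_mult X (a k) (b k)"])
    have "(\<lambda>k. \<delta> (cfun_add X (a k) (b k))) \<longlonglongrightarrow> l f + l g"
      using tendsto_add[OF lims(1,2)] a(1) b(1) by (simp add: add)
    then show "l (cfun_add X f g) = l f + l g"
      using l[OF 1 ab(1) uniform_limit_cfun_add[OF a(2) b(2)]] by (rule LIMSEQ_unique[rotated])
    have "(\<lambda>k. \<delta> (cfun_mult X (a k) (b k))) \<longlonglongrightarrow> l f * g x + f x * l g"
      using tendsto_add[OF tendsto_mult[OF lims(1,4)] tendsto_mult[OF lims(3,2)]] a(1) b(1)
      by (simp add: mult)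
    then show "l (cfun_mult X f g) = l f * g x + f x * l g"
      using l[OF 2 ab(2) uniform_limit_cfun_mult[OF X X_fg a(2) b(2)]] by (rule LIMSEQ_unique[rotated])
  qed
  have AB: "A \<subseteq> B"
    unfolding B_def by (rule subset_uniform_closure[OF X AX])
  have l_A: "l f = \<delta> f" if "f \<in> A" for f
  proof -
    have "(\<lambda>k::nat. \<delta> f) \<longlonglongrightarrow> l f"
      using that AB by (intro l) (auto intro!: uniform_limitI)
    then show ?thesis
      by (simp add: LIMSEQ_const_iff)
  qed
  have "\<delta> (cfun_const X 1) = \<delta> (cfun_const X 1) + \<delta> (cfun_const X 1)"
    using mult[OF A_const[of 1] A_const[of 1]] x by (simp add: cfun_mult_def cfun_const_def cong: restrict_cong)
  then have \<delta>_1: "\<delta> (cfun_const X 1) = 0"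
    by simp
  have l_const: "l (cfun_const X c) = 0" for c
  proof -
    have "cfun_const X c = cfun_scale X c (cfun_const X 1)"
      by (auto simp: cfun_scale_def cfun_const_def)
    then show ?thesis
      using l_A[OF A_const, of c] scale[OF A_const, of c 1] \<delta>_1 by simp
  qed
  have B_scale: "cfun_scale X c f \<in> B" and l_scale: "l (cfun_scale X c f) = c * l f" if "f \<in> B" for c f
  proof -
    have "cfun_const X c \<in> B"
      using AB A_const by blast
    then show "cfun_scale X c f \<in> B" "l (cfun_scale X c f) = c * l f"
      using that B_mult l_mult l_const x by (simp_all add: cfun_scale_eq_mult cfun_const_def)
  qed
  have lip_l: "dist (l f) (l g) \<le> mdist (cfun_metric X) f g" if fg: "f \<in> B" "g \<in> B" for f g
  proof (rule field_le_epsilon)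
    fix e :: real assume e: "e > 0"
    obtain a where a: "\<forall>k. a k \<in> A" "uniform_limit (topspace X) a f sequentially"
      using fg(1) unfolding iff by blast
    obtain b where b: "\<forall>k. b k \<in> A" "uniform_limit (topspace X) b g sequentially"
      using fg(2) unfolding iff by blast
    have "\<And>y. y \<in> topspace X \<Longrightarrow> dist (f y) (g y) \<le> mdist (cfun_metric X) f g"
      using mdist_cfun_le_iff[OF X, of f g "mdist (cfun_metric X) f g"] fg by (simp add: iff)
    then obtain N where "\<forall>m\<ge>N. \<forall>n\<ge>N. dist (\<delta> (a m)) (\<delta> (b n)) \<le> mdist (cfun_metric X) f g + e"
      using close[OF a(1)[rule_format] a(2) b(1)[rule_format] b(2) _ e] by blast
    then show "dist (l f) (l g) \<le> mdist (cfun_metric X) f g + e"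
      by (intro LIMSEQ_le_const2[OF tendsto_dist[OF l[OF fg(1) a] l[OF fg(2) b]]]) auto
  qed
  define \<psi> where "\<psi> = (\<lambda>f\<in>B. l f)"
  have "Lipschitz_continuous_map (submetric (cfun_metric X) B) euclidean_metric \<psi>"
    unfolding Lipschitz_continuous_map_def
    by (intro conjI exI[of _ 1]) (auto simp: \<psi>_def lip_l)
  then have "continuous_map (subtopology (mtopology_of (cfun_metric X)) B) euclidean \<psi>"
    using Lipschitz_continuous_imp_continuous_map by (force simp: mtopology_of_submetric)
  then have "bounded_point_derivation X B (\<lambda>f\<in>B. f x) \<psi>"
    unfolding bounded_point_derivation_def point_derivation_def linear_functional_def
    by (auto simp: \<psi>_def B_add B_mult B_scale l_add l_mult l_scale)
  moreover have "\<forall>f\<in>A. \<psi> f = \<delta> f"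
    using AB l_A by (auto simp: \<psi>_def)
  ultimately show ?thesis
    unfolding B_def by blast
qed

section \<open>Polynomials in finitely many coordinates\<close>

text \<open>\<open>cpoly n\<close> consists of the polynomials in the coordinates \<open>z 0, \<dots>, z (n - 1)\<close>, generated
  as sums of terms that are monomial in the last coordinate.  This shape gives an induction in
  which the last coordinate alone can be averaged out.\<close>

inductive cpoly :: "nat \<Rightarrow> ((nat \<Rightarrow> complex) \<Rightarrow> complex) \<Rightarrow> bool" where
  const0: "cpoly 0 (\<lambda>_. c)"
| monomial: "cpoly n a \<Longrightarrow> cpoly (Suc n) (\<lambda>z. a z * z n ^ k)"
| add: "cpoly n p \<Longrightarrow> cpoly n q \<Longrightarrow> cpoly n (\<lambda>z. p z + q z)"

lemma cpoly_cong_coordinates: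
  "cpoly n p \<Longrightarrow> (\<And>i. i < n \<Longrightarrow> z i = w i) \<Longrightarrow> p z = p w"
  by (induction arbitrary: z w rule: cpoly.induct) (metis less_Suc_eq)+

lemma cpoly_Suc: "cpoly n p \<Longrightarrow> cpoly (Suc n) p"
  using cpoly.monomial[of n p 0] by simp

lemma cpoly_mono: "cpoly n p \<Longrightarrow> n \<le> m \<Longrightarrow> cpoly m p"
  by (induction m) (auto simp: le_Suc_eq intro: cpoly_Suc)

lemma cpoly_const: "cpoly n (\<lambda>_. c)"
  using cpoly_mono[OF const0] by simp

lemma cpoly_coordinate: "i < n \<Longrightarrow> cpoly n (\<lambda>z. z i)"
  using cpoly_mono[OF monomial[OF cpoly_const[of i 1], of 1], of n] by simp

lemma cpoly_cmult: "cpoly n p \<Longrightarrow> cpoly n (\<lambda>z. c * p z)"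
proof (induction rule: cpoly.induct)
  case (const0 c')
  show ?case by (rule cpoly.const0)
next
  case (monomial n a k)
  show ?case
    using cpoly.monomial[OF monomial.IH, of k] by (simp add: mult.assoc)
next
  case (add n p q)
  show ?case
    using cpoly.add[OF add.IH] by (simp add: distrib_left)
qed

lemma cpoly_mult: "cpoly n p \<Longrightarrow> cpoly n q \<Longrightarrow> cpoly n (\<lambda>z. p z * q z)"
proof (induction arbitrary: q rule: cpoly.induct)
  case (const0 c)
  then show ?case by (rule cpoly_cmult)
next
  case (monomial n a k)
  from monomial.prems show ?case
  proof (induction "Suc n" q rule: cpoly.induct)
    case (monomial b l)
    have "cpoly (Suc n) (\<lambda>z. (a z * b z) * z n ^ (k + l))"
      by (intro cpoly.monomial \<open>\<And>q. cpoly n q \<Longrightarrow> cpoly n (\<lambda>z. a z * q z)\<close> monomial.hyps)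
    then show ?case
      by (simp add: power_add mult_ac)
  next
    case (add p q)
    then show ?case
      using cpoly.add[OF add.hyps(2,4)] by (simp add: distrib_left)
  qed
next
  case (add n p p')
  then show ?case
    using cpoly.add[OF add.IH(1)[OF add.prems] add.IH(2)[OF add.prems]] by (simp add: distrib_right)
qed

lemma cpoly_power: "cpoly n p \<Longrightarrow> cpoly n (\<lambda>z. p z ^ k)"
  by (induction k) (auto intro: cpoly_const cpoly_mult)

lemma cpoly_diff: "cpoly n p \<Longrightarrow> cpoly n q \<Longrightarrow> cpoly n (\<lambda>z. p z - q z)"
  using cpoly.add[OF _ cpoly_cmult[of n q "-1"], of p] by simp

lemma continuous_on_cpoly: "cpoly n p \<Longrightarrow> continuous_on S p"
  by (induction rule: cpoly.induct)
     (auto intro!: continuous_intros intro: continuous_on_subset[OF continuous_on_product_coordinates])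

section \<open>The derivative along the first axis\<close>

definition axis_point :: "complex \<Rightarrow> nat \<Rightarrow> complex" where
  "axis_point t = (\<lambda>k. if k = 0 then t else 0)"

definition axis_deriv :: "((nat \<Rightarrow> complex) \<Rightarrow> complex) \<Rightarrow> complex" where
  "axis_deriv p = deriv (\<lambda>t. p (axis_point t)) 0"

lemma holomorphic_on_axis: "cpoly n p \<Longrightarrow> (\<lambda>t. p (axis_point t)) holomorphic_on S"
proof (induction rule: cpoly.induct)
  case (monomial n a k)
  have "(\<lambda>t. axis_point t n) holomorphic_on S"
    by (cases "n = 0") (simp_all add: axis_point_def)
  with monomial.IH show ?case
    by (intro holomorphic_intros)
qed (auto intro: holomorphic_intros)

lemma field_differentiable_on_axis:
  "cpoly n p \<Longrightarrow> (\<lambda>t. p (axis_point t)) field_differentiable at 0"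
  using holomorphic_on_imp_differentiable_at[OF holomorphic_on_axis open_UNIV] by blast

lemma axis_deriv_const: "axis_deriv (\<lambda>_. c) = 0"
  by (simp add: axis_deriv_def)

lemma axis_deriv_add:
  "cpoly n p \<Longrightarrow> cpoly n q \<Longrightarrow> axis_deriv (\<lambda>z. p z + q z) = axis_deriv p + axis_deriv q"
  unfolding axis_deriv_def by (intro deriv_add field_differentiable_on_axis)

lemma axis_deriv_mult:
  "cpoly n p \<Longrightarrow> cpoly n q \<Longrightarrow>
     axis_deriv (\<lambda>z. p z * q z) = axis_deriv p * q (axis_point 0) + p (axis_point 0) * axis_deriv q"
  unfolding axis_deriv_def by (subst deriv_mult) (auto intro: field_differentiable_on_axis)

lemma axis_deriv_cmult: "cpoly n p \<Longrightarrow> axis_deriv (\<lambda>z. c * p z) = c * axis_deriv p"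
  using axis_deriv_mult[OF cpoly_const, of n p c] by (simp add: axis_deriv_const)

lemma axis_deriv_diff:
  "cpoly n p \<Longrightarrow> cpoly n q \<Longrightarrow> axis_deriv (\<lambda>z. p z - q z) = axis_deriv p - axis_deriv q"
  using axis_deriv_add[OF _ cpoly_cmult[of n q "-1"], of p] axis_deriv_cmult[of n q "-1"] by simp

lemma axis_deriv_coordinate: "axis_deriv (\<lambda>z. z i) = (if i = 0 then 1 else 0)"
  by (cases "i = 0") (simp_all add: axis_deriv_def axis_point_def)

text \<open>A polynomial vanishing to second order along the axis stays invisible to the derivative
  when it is raised to positive powers and multiplied by others.\<close>

lemma axis_deriv_mult_power:
  assumes "cpoly n a" "cpoly n q" "q (axis_point 0) = 0" "axis_deriv q = 0"
  shows "axis_deriv (\<lambda>z. a z * q z ^ Suc k) = 0"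
proof -
  have "axis_deriv (\<lambda>z. (a z * q z ^ k) * q z) = 0"
    unfolding axis_deriv_mult[OF cpoly_mult[OF assms(1) cpoly_power[OF assms(2)]] assms(2)]
    by (simp add: assms(3,4))
  then show ?thesis
    by (simp add: mult_ac)
qed

section \<open>The tower of root extensions\<close>

lemma ex_dense_seq: "\<exists>d :: nat \<Rightarrow> complex. \<forall>z e. e > 0 \<longrightarrow> (\<exists>l. dist (d l) z < e)"
proof -
  obtain D :: "complex set" where D: "countable D" "\<And>U. open U \<Longrightarrow> U \<noteq> {} \<Longrightarrow> \<exists>d\<in>D. d \<in> U"
    by (rule countable_dense_setE) blast
  have "\<exists>l. dist (from_nat_into D l) z < e" if "e > 0" for z e
  proof -
    obtain w where "w \<in> D" "w \<in> ball z e"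
      using D(2)[of "ball z e"] \<open>e > 0\<close> by auto
    then show ?thesis
      using from_nat_into_surj[OF D(1)] by (metis dist_commute mem_ball)
  qed
  then show ?thesis by blast
qed

text \<open>Countably many equations must serve all pairs of points, so the centre $d$ in
  $(z_i - d)\,z_j^2$ runs through a dense sequence; this keeps the space metrizable.\<close>

definition dense_seq :: "nat \<Rightarrow> complex" where
  "dense_seq = (SOME d. \<forall>z e. e > 0 \<longrightarrow> (\<exists>l. dist (d l) z < e))"

lemma dense_seq: "e > 0 \<Longrightarrow> \<exists>l. dist (dense_seq l) z < e"
  using someI_ex[OF ex_dense_seq] unfolding dense_seq_def by blast

text \<open>The equation number \<open>n\<close> encodes the two coordinates, the centre and the degree of the
  root.  The pairing function dominates its arguments, so the radicand of coordinate \<open>Suc n\<close> only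
  involves coordinates up to \<open>n\<close>, and its degree is a successor, hence positive.\<close>

definition index_code :: "nat \<Rightarrow> nat \<Rightarrow> nat \<Rightarrow> nat \<Rightarrow> nat" where
  "index_code i j l m = prod_encode (i, prod_encode (j, prod_encode (l, m)))"

definition fst_index :: "nat \<Rightarrow> nat" where
  "fst_index n = fst (prod_decode n)"

definition snd_index :: "nat \<Rightarrow> nat" where
  "snd_index n = fst (prod_decode (snd (prod_decode n)))"

definition centre :: "nat \<Rightarrow> complex" where
  "centre n = dense_seq (fst (prod_decode (snd (prod_decode (snd (prod_decode n))))))"

definition root_degree :: "nat \<Rightarrow> nat" where
  "root_degree n = Suc (snd (prod_decode (snd (prod_decode (snd (prod_decode n))))))"

definition radicand :: "nat \<Rightarrow> (nat \<Rightarrow> complex) \<Rightarrow> complex" where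
  "radicand n z = (z (fst_index n) - centre n) * z (snd_index n) ^ 2"

lemma index_code_simps [simp]:
  "fst_index (index_code i j l m) = i" "snd_index (index_code i j l m) = j"
  "centre (index_code i j l m) = dense_seq l" "root_degree (index_code i j l m) = Suc m"
  by (simp_all add: index_code_def fst_index_def snd_index_def centre_def root_degree_def)

lemma root_degree_pos [simp]: "0 < root_degree n"
  by (simp add: root_degree_def)

lemma fst_prod_decode_le: "fst (prod_decode n) \<le> n"
  and snd_prod_decode_le: "snd (prod_decode n) \<le> n"
  by (metis le_prod_encode_1 prod.collapse prod_decode_inverse)
     (metis le_prod_encode_2 prod.collapse prod_decode_inverse)

lemma index_le [simp]: "fst_index n \<le> n" "snd_index n \<le> n"
  unfolding fst_index_def snd_index_def
  by (rule fst_prod_decode_le) (meson fst_prod_decode_le snd_prod_decode_le order_trans)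

lemma cpoly_radicand: "cpoly (Suc n) (radicand n)"
  unfolding radicand_def [abs_def]
  by (intro cpoly_mult cpoly_diff cpoly_power cpoly_coordinate cpoly_const) (simp_all add: le_imp_less_Suc)

lemma radicand_cong: "(\<And>i. i \<le> n \<Longrightarrow> z i = w i) \<Longrightarrow> radicand n z = radicand n w"
  by (simp add: radicand_def)

lemma radicand_origin: "radicand n (axis_point 0) = 0"
  by (simp add: radicand_def axis_point_def)

text \<open>The squared factor makes every radicand vanish to second order at the origin along the
  axis, also when \<open>snd_index n = 0\<close>.  This is what lets the derivation survive the adjunction of
  roots.\<close>

lemma axis_deriv_radicand: "axis_deriv (radicand n) = 0"
proof -
  define N where "N = Suc n"
  have c: "cpoly N (\<lambda>z. z (snd_index n))" "cpoly N (\<lambda>z. z (fst_index n) - centre n)"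
    unfolding N_def by (intro cpoly_diff cpoly_coordinate cpoly_const; simp add: le_imp_less_Suc)+
  have sq: "axis_deriv (\<lambda>z. z (snd_index n) ^ 2) = 0"
    unfolding power2_eq_square axis_deriv_mult[OF c(1) c(1)] by (simp add: axis_point_def)
  show ?thesis
    unfolding radicand_def [abs_def] axis_deriv_mult[OF c(2) cpoly_power[OF c(1)]] sq
    by (simp add: axis_point_def)
qed

text \<open>\<open>tower n\<close> imposes only the first \<open>n\<close> equations, so that it governs the coordinates up to \<open>n\<close>
  and leaves the others free; for \<open>n = 0\<close> only \<open>z 0\<close> is restricted, to the closed unit disc.\<close>

definition tower :: "nat \<Rightarrow> (nat \<Rightarrow> complex) set" where
  "tower n = {z. cmod (z 0) \<le> 1 \<and> (\<forall>k<n. z (Suc k) ^ root_degree k = radicand k z)}"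

definition root_space :: "(nat \<Rightarrow> complex) set" where
  "root_space = {z. cmod (z 0) \<le> 1 \<and> (\<forall>k. z (Suc k) ^ root_degree k = radicand k z)}"

lemma sum_roots_of_unity_power:
  assumes "m > 0"
  shows "(\<Sum>u | u ^ m = 1. (u::complex) ^ k) = (if m dvd k then of_nat m else 0)"
proof (cases "m dvd k")
  case True
  then have "u ^ k = 1" if "u ^ m = 1" for u :: complex
    using that by (auto simp: power_mult elim!: dvdE)
  then have "(\<Sum>u | u ^ m = 1. (u::complex) ^ k) = (\<Sum>u | (u::complex) ^ m = 1. 1)"
    by (intro sum.cong) auto
  then show ?thesis
    using True assms by (simp add: card_complex_roots_unity)
next
  case False
  define v where "v = exp (2 * of_real pi * \<i> * of_nat 1 / of_nat m)"
  have v: "v ^ m = 1"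
    unfolding v_def using assms by (intro complex_root_unity) auto
  have "v ^ k = exp (2 * of_real pi * \<i> * of_nat k / of_nat m)"
    unfolding v_def exp_of_nat_mult[symmetric] by (simp add: mult_ac)
  then have vk: "v ^ k \<noteq> 1"
    using False assms by (simp add: complex_root_unity_eq_1)
  have v0: "v \<noteq> 0"
    by (simp add: v_def)
  have "(\<Sum>u | u ^ m = 1. u ^ k) = (\<Sum>u | u ^ m = 1. (v * u) ^ k)"
    by (rule sum.reindex_bij_witness[of _ "\<lambda>u. v * u" "\<lambda>u. u / v"])
       (use v v0 in \<open>auto simp: power_mult_distrib power_divide\<close>)
  also have "\<dots> = v ^ k * (\<Sum>u | u ^ m = 1. u ^ k)"
    by (simp add: power_mult_distrib sum_distrib_left)
  finally have "(1 - v ^ k) * (\<Sum>u | u ^ m = 1. u ^ k) = 0"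
    by (simp add: algebra_simps)
  then show ?thesis
    using vk False by simp
qed

lemma ex_complex_root: "m > 0 \<Longrightarrow> \<exists>w::complex. w ^ m = c"
  by (metis exists_complex_root less_numeral_extra(3))

text \<open>Averaging a polynomial over the roots $w$ of $w^m = q(z)$ kills the powers $w^k$ with
  $m \nmid k$ and turns $w^{mr}$ into $q(z)^r$: the result is a polynomial in the earlier
  coordinates.  The derivative along the axis does not change: there $w$ is zero and $q$ vanishes to
  second order, so on both sides only the term free of $w$ counts.\<close>

lemma root_average:
  assumes "cpoly (Suc (Suc n)) p"
  shows "\<exists>s. cpoly (Suc n) s \<and> axis_deriv s = axis_deriv p \<and>
           (\<forall>z w. w ^ root_degree n = radicand n z \<longrightarrow>
              (\<Sum>u | u ^ root_degree n = 1. p (z(Suc n := u * w))) = of_nat (root_degree n) * s z)"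
  using assms
proof (induction "Suc (Suc n)" p rule: cpoly.induct)
  case (monomial a k)
  define m where "m = root_degree n"
  have m: "m > 0"
    by (simp add: m_def)
  have sum_eq: "(\<Sum>u | u ^ m = 1. a (z(Suc n := u * w)) * (z(Suc n := u * w)) (Suc n) ^ k)
      = a z * w ^ k * (if m dvd k then of_nat m else 0)" for z w
  proof -
    have "a (z(Suc n := u * w)) = a z" for u
      by (rule cpoly_cong_coordinates[OF monomial.hyps(1)]) simp
    then have "(\<Sum>u | u ^ m = 1. a (z(Suc n := u * w)) * (z(Suc n := u * w)) (Suc n) ^ k)
        = (\<Sum>u | u ^ m = 1. a z * w ^ k * u ^ k)"
      by (simp add: power_mult_distrib mult_ac)
    then show ?thesis
      by (simp only: sum_distrib_left[symmetric] sum_roots_of_unity_power[OF m])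
  qed
  have zero: "axis_deriv (\<lambda>z. a z * z (Suc n) ^ k) = 0" if "k > 0"
    using that by (simp add: axis_deriv_def axis_point_def power_0_left)
  show ?case
  proof (cases "m dvd k")
    case True
    then obtain r where r: "k = m * r" by (elim dvdE)
    define s where "s = (\<lambda>z. a z * radicand n z ^ r)"
    have "cpoly (Suc n) s"
      unfolding s_def by (intro cpoly_mult cpoly_power cpoly_radicand monomial.hyps)
    moreover have "axis_deriv s = axis_deriv (\<lambda>z. a z * z (Suc n) ^ k)"
    proof (cases r)
      case 0
      then show ?thesis
        using r by (simp add: s_def)
    next
      case (Suc r')
      have "axis_deriv s = 0"
        unfolding s_def Suc
        by (rule axis_deriv_mult_power[OF monomial.hyps(1) cpoly_radicand radicand_origin
              axis_deriv_radicand])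
      with zero Suc r m show ?thesis by simp
    qed
    moreover have "(\<Sum>u | u ^ m = 1. a (z(Suc n := u * w)) * (z(Suc n := u * w)) (Suc n) ^ k) = of_nat m * s z"
      if "w ^ m = radicand n z" for z w
      unfolding sum_eq using that True by (simp add: s_def r power_mult)
    ultimately show ?thesis
      unfolding m_def by blast
  next
    case False
    then have "k > 0" by (auto intro: gr0I)
    show ?thesis
      using sum_eq False zero[OF \<open>k > 0\<close>] unfolding m_def
      by (intro exI[of _ "\<lambda>_. 0"]) (simp add: cpoly_const axis_deriv_const)
  qed
next
  case (add p q)
  then obtain s t where s: "cpoly (Suc n) s" "axis_deriv s = axis_deriv p"
      "\<And>z w. w ^ root_degree n = radicand n z \<Longrightarrow>
         (\<Sum>u | u ^ root_degree n = 1. p (z(Suc n := u * w))) = of_nat (root_degree n) * s z"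
    and t: "cpoly (Suc n) t" "axis_deriv t = axis_deriv q"
      "\<And>z w. w ^ root_degree n = radicand n z \<Longrightarrow>
         (\<Sum>u | u ^ root_degree n = 1. q (z(Suc n := u * w))) = of_nat (root_degree n) * t z"
    by metis
  show ?case
    by (intro exI[of _ "\<lambda>z. s z + t z"])
       (simp add: cpoly.add s t axis_deriv_add[OF s(1) t(1)] axis_deriv_add[OF add.hyps(1,3)]
         sum.distrib distrib_left)
qed

text \<open>An average is no larger than the supremum, so the root coordinates can be removed one at a
  time without increasing the bound.  What remains is a polynomial on the unit disc, where
  Cauchy's inequality applies.\<close>

lemma axis_deriv_le_tower:
  assumes "cpoly (Suc n) p" "\<And>z. z \<in> tower n \<Longrightarrow> cmod (p z) \<le> C"
  shows "cmod (axis_deriv p) \<le> C"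
  using assms
proof (induction n arbitrary: p)
  case 0
  have "cmod ((deriv ^^ 1) (\<lambda>t. p (axis_point t)) 0) \<le> fact 1 * C / 1 ^ 1"
  proof (rule Cauchy_inequality)
    show "cmod (p (axis_point t)) \<le> C" if "cmod (0 - t) = 1" for t
      using that by (intro 0) (simp add: tower_def axis_point_def)
  qed (use 0 in \<open>auto intro: holomorphic_on_axis holomorphic_on_imp_continuous_on\<close>)
  then show ?case
    by (simp add: axis_deriv_def)
next
  case (Suc n)
  define m where "m = root_degree n"
  have m: "m > 0" by (simp add: m_def)
  obtain s where s: "cpoly (Suc n) s" "axis_deriv s = axis_deriv p"
    "\<And>z w. w ^ m = radicand n z \<Longrightarrow> (\<Sum>u | u ^ m = 1. p (z(Suc n := u * w))) = of_nat m * s z"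
    using root_average[OF Suc.prems(1)] unfolding m_def by blast
  have "cmod (s z) \<le> C" if z: "z \<in> tower n" for z
  proof -
    obtain w where w: "w ^ m = radicand n z"
      using ex_complex_root[OF m] by blast
    have "z(Suc n := u * w) \<in> tower (Suc n)" if u: "u ^ m = 1" for u
    proof -
      have "radicand k (z(Suc n := u * w)) = radicand k z" if "k \<le> n" for k
        using that by (intro radicand_cong) auto
      then show ?thesis
        using z u w by (auto simp: tower_def less_Suc_eq power_mult_distrib m_def)
    qed
    then have "cmod (\<Sum>u | u ^ m = 1. p (z(Suc n := u * w))) \<le> (\<Sum>u | (u::complex) ^ m = 1. C)"
      by (intro sum_norm_le) (auto intro: Suc.prems(2))
    then have "real m * cmod (s z) \<le> real m * C"
      using m unfolding s(3)[OF w] by (simp add: norm_mult card_complex_roots_unity)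
    then show ?thesis
      using m by simp
  qed
  then show ?case
    using Suc.IH[OF s(1)] s(2) by simp
qed

text \<open>The remaining coordinates are chosen successively as roots of their radicands.\<close>

lemma tower_extends:
  assumes z: "z \<in> tower n"
  shows "\<exists>y\<in>root_space. \<forall>i\<le>n. y i = z i"
proof -
  \<comment> \<open>Coordinate \<open>k\<close> satisfies equation number \<open>k - 1\<close>; here \<open>k > n \<ge> 0\<close>.\<close>
  define P where "P f k r \<longleftrightarrow>
    (if k \<le> n then r = z k else r ^ root_degree (k - 1) = radicand (k - 1) f)" for f k r
  have "\<exists>f. \<forall>k. P f k (f k)"
  proof (rule dependent_wellorder_choice)
    fix r f g and k :: nat assume eq: "\<And>y. y < k \<Longrightarrow> f y = (g y :: complex)"
    have "radicand (k - 1) f = radicand (k - 1) g" if "k > n"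
      using that by (intro radicand_cong eq) auto
    then show "P f k r = P g k r"
      by (simp add: P_def)
  next
    fix k f
    show "\<exists>r. P f k r"
      unfolding P_def using ex_complex_root[OF root_degree_pos] by (cases "k \<le> n") auto
  qed
  then obtain y where y: "\<And>k. P y k (y k)" by blast
  have y_eq: "y i = z i" if "i \<le> n" for i
    using y[of i] that by (simp add: P_def)
  have "y (Suc k) ^ root_degree k = radicand k y" for k
  proof (cases "k < n")
    case True
    then have "radicand k y = radicand k z"
      by (intro radicand_cong y_eq) simp
    with True z show ?thesis
      by (simp add: y_eq tower_def)
  next
    case False
    then show ?thesis
      using y[of "Suc k"] by (simp add: P_def)
  qed
  moreover have "cmod (y 0) \<le> 1"
    using z by (simp add: y_eq tower_def)
  ultimately have "y \<in> root_space"
    by (simp add: root_space_def)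
  with y_eq show ?thesis by blast
qed

lemma axis_deriv_le:
  assumes p: "cpoly n p" and le: "\<And>z. z \<in> root_space \<Longrightarrow> cmod (p z) \<le> C"
  shows "cmod (axis_deriv p) \<le> C"
proof (rule axis_deriv_le_tower[OF cpoly_Suc[OF p]])
  fix z assume "z \<in> tower n"
  then obtain y where "y \<in> root_space" "\<forall>i\<le>n. y i = z i"
    using tower_extends by blast
  moreover from this have "p y = p z"
    by (intro cpoly_cong_coordinates[OF p]) simp
  ultimately show "cmod (p z) \<le> C"
    using le by metis
qed

lemma origin_in_root_space: "axis_point 0 \<in> root_space"
  by (simp add: root_space_def radicand_origin) (simp add: axis_point_def)

text \<open>By induction the radicand is bounded, by $M$ say, and $|w| \le |w|^m \le M$ as soon as
  $|w| > 1$.\<close>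

lemma root_space_coordinate_bounded: "\<exists>R\<ge>0. \<forall>z\<in>root_space. cmod (z n) \<le> R"
proof (induction n rule: less_induct)
  case (less n)
  show ?case
  proof (cases n)
    case 0
    then show ?thesis
      by (intro exI[of _ 1]) (simp add: root_space_def)
  next
    case (Suc k)
    obtain R where R: "R \<ge> 0" "\<And>z. z \<in> root_space \<Longrightarrow> cmod (z (fst_index k)) \<le> R"
      using less[of "fst_index k"] Suc by (metis index_le(1) le_imp_less_Suc)
    obtain S where S: "S \<ge> 0" "\<And>z. z \<in> root_space \<Longrightarrow> cmod (z (snd_index k)) \<le> S"
      using less[of "snd_index k"] Suc by (metis index_le(2) le_imp_less_Suc)
    define M where "M = (R + cmod (centre k)) * S ^ 2"
    have "cmod (z n) \<le> max 1 M" if z: "z \<in> root_space" for z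
    proof (cases "cmod (z n) \<le> 1")
      case False
      have "cmod (z n) ^ 1 \<le> cmod (z n) ^ root_degree k"
        using False by (intro power_increasing) (auto simp: Suc_leI)
      also have "\<dots> = cmod (radicand k z)"
        using z Suc by (simp add: root_space_def flip: norm_power)
      also have "\<dots> \<le> M"
        unfolding radicand_def norm_mult norm_power M_def
        using R S z norm_triangle_ineq4[of "z (fst_index k)" "centre k"]
        by (intro mult_mono power_mono) (auto intro: order_trans add_right_mono)
      finally show ?thesis by simp
    qed simp
    then show ?thesis
      by (intro exI[of _ "max 1 M"]) auto
  qed
qed

lemma compact_root_space: "compact root_space"
proof -
  obtain R where R: "\<And>n z. z \<in> root_space \<Longrightarrow> cmod (z n) \<le> R n"
    using root_space_coordinate_bounded by metis
  have "compactin (product_topology (\<lambda>_. euclidean) UNIV) (PiE UNIV (\<lambda>n::nat. cball (0::complex) (R n)))"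
    by (simp add: compactin_PiE)
  then have "compact (PiE UNIV (\<lambda>n::nat. cball (0::complex) (R n)))"
    by (simp add: euclidean_product_topology)
  moreover have "closed root_space"
  proof -
    have "closed {z :: nat \<Rightarrow> complex. cmod (z 0) \<le> 1}"
      by (intro closed_Collect_le continuous_intros) auto
    moreover have "closed {z. z (Suc k) ^ root_degree k = radicand k z}" for k
      by (intro closed_Collect_eq continuous_on_cpoly[OF cpoly_power[OF cpoly_coordinate]]
          continuous_on_cpoly[OF cpoly_radicand]) auto
    moreover have "root_space = {z. cmod (z 0) \<le> 1} \<inter> (\<Inter>k. {z. z (Suc k) ^ root_degree k = radicand k z})"
      by (auto simp: root_space_def)
    ultimately show ?thesis
      by (metis (no_types, lifting) closed_INT closed_Int)
  qed
  ultimately have "compact (PiE UNIV (\<lambda>n. cball 0 (R n)) \<inter> root_space)"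
    by (rule compact_Int_closed)
  moreover have "PiE UNIV (\<lambda>n. cball 0 (R n)) \<inter> root_space = root_space"
    using R by (auto simp: dist_norm)
  ultimately show ?thesis by simp
qed

text \<open>The function $q = (z_i - x_i)\,z_j^2$ vanishes at \<open>x\<close> but not at \<open>y\<close>.  With the centre moved to
  a member of the dense sequence close to $x_i$, its roots of order $k+1$ are coordinates.  High
  roots push the value at \<open>y\<close>, once normalised, towards modulus $1$, while the value at \<open>x\<close> stays
  small if the centre is chosen close enough for the given $k$.\<close>

lemma separating_sequence:
  assumes x: "x \<in> root_space" and y: "y \<in> root_space" and ne: "x \<noteq> y" "y j \<noteq> 0"
  shows "\<exists>p. (\<forall>k. \<exists>n. cpoly n (p k)) \<and> (\<forall>k. \<forall>z\<in>root_space. cmod (p k z) \<le> 1) \<and>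
             (\<lambda>k. p k x) \<longlonglongrightarrow> 0 \<and> (\<lambda>k. cmod (p k y)) \<longlonglongrightarrow> 1"
proof -
  obtain i where i: "x i \<noteq> y i"
    using ne(1) by blast
  obtain R where R: "R \<ge> 0" "\<And>z. z \<in> root_space \<Longrightarrow> cmod (z i) \<le> R"
    using root_space_coordinate_bounded by blast
  obtain S where S: "S \<ge> 0" "\<And>z. z \<in> root_space \<Longrightarrow> cmod (z j) \<le> S"
    using root_space_coordinate_bounded by blast
  define a where "a = cmod (y i - x i)"
  define c where "c = a / 2 * cmod (y j) ^ 2"
  \<comment> \<open>\<open>M\<close> bounds every radicand with indices \<open>i\<close>, \<open>j\<close> and centre within distance \<open>1\<close> of \<open>x i\<close>.\<close>
  define M where "M = max 1 ((R + cmod (x i) + 1) * S ^ 2)"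
  \<comment> \<open>The three bounds control the size of the centre, the value at \<open>y\<close> and the value at \<open>x\<close>; the
    last one is such that the root of order \<open>Suc k\<close> at \<open>x\<close> is at most \<open>1 / Suc k\<close>.\<close>
  define e where "e k = min (min 1 (a / 2)) ((1 / real (Suc k)) ^ Suc k / (S\<^sup>2 + 1))" for k
  have a: "a > 0"
    using i by (simp add: a_def)
  have c: "c > 0"
    using a ne(2) by (simp add: c_def)
  have M: "M \<ge> 1"
    by (simp add: M_def)
  have S2: "S\<^sup>2 + 1 > 0"
    by (simp add: add_nonneg_pos)
  have "e k > 0" for k
    using a S2 by (simp add: e_def)
  then have "\<forall>k. \<exists>l. dist (dense_seq l) (x i) < e k"
    using dense_seq by blast
  then obtain l where l: "\<And>k. dist (dense_seq (l k)) (x i) < e k"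
    by metis
  define N where "N k = Suc (index_code i j (l k) k)" for k
  define p where "p k = (\<lambda>z::nat \<Rightarrow> complex. of_real (1 / root (Suc k) M) * z (N k))" for k
  have pow: "cmod (z (N k)) ^ Suc k = cmod (z i - dense_seq (l k)) * cmod (z j) ^ 2"
    if "z \<in> root_space" for z k
  proof -
    have "z (N k) ^ root_degree (index_code i j (l k) k) = radicand (index_code i j (l k) k) z"
      using that unfolding root_space_def N_def by blast
    then have "cmod (z (N k) ^ Suc k) = cmod ((z i - dense_seq (l k)) * z j ^ 2)"
      by (simp add: radicand_def)
    then show ?thesis
      by (simp only: norm_power norm_mult)
  qed
  have rootM: "root (Suc k) M \<ge> 1" for k
    using M by simp
  have p_norm: "cmod (p k z) = cmod (z (N k)) / root (Suc k) M" for k z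
    using rootM[of k] by (simp add: p_def norm_mult norm_divide)
  have "cpoly (Suc (N k)) (p k)" for k
    unfolding p_def by (intro cpoly_cmult cpoly_coordinate) simp
  moreover have p1: "cmod (p k z) \<le> 1" if z: "z \<in> root_space" for k z
  proof -
    have "cmod (z i - dense_seq (l k)) \<le> R + cmod (x i) + 1"
    proof -
      have "cmod (z i - dense_seq (l k)) \<le> cmod (z i) + cmod (x i) + dist (dense_seq (l k)) (x i)"
        using norm_triangle_ineq4[of "z i - x i" "dense_seq (l k) - x i"] norm_triangle_ineq4[of "z i" "x i"]
        by (simp add: dist_norm)
      then show ?thesis
        using R(2)[OF z] l[of k] by (simp add: e_def)
    qed
    then have "cmod (z (N k)) ^ Suc k \<le> (R + cmod (x i) + 1) * S ^ 2"
      unfolding pow[OF z] using R(1) S(2)[OF z] by (intro mult_mono power_mono) auto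
    then have "cmod (z (N k)) ^ Suc k \<le> M"
      by (simp add: M_def)
    then have "root (Suc k) (cmod (z (N k)) ^ Suc k) \<le> root (Suc k) M"
      by (subst real_root_le_iff) auto
    then have "cmod (z (N k)) \<le> root (Suc k) M"
      by (subst (asm) real_root_power_cancel) auto
    then show ?thesis
      using rootM[of k] by (simp add: p_norm)
  qed
  moreover have "(\<lambda>k. p k x) \<longlonglongrightarrow> 0"
  proof (rule Lim_null_comparison)
    have "cmod (p k x) \<le> 1 / real (Suc k)" for k
    proof -
      have "cmod (x (N k)) ^ Suc k \<le> (1 / real (Suc k)) ^ Suc k / (S\<^sup>2 + 1) * S\<^sup>2"
        unfolding pow[OF x]
        using l[of k] S(2)[OF x] S2
        by (intro mult_mono power_mono) (auto simp: e_def dist_norm norm_minus_commute)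
      also have "\<dots> \<le> (1 / real (Suc k)) ^ Suc k"
        using S2 by (simp add: divide_simps)
      finally have "cmod (x (N k)) \<le> 1 / real (Suc k)"
        by (rule power_le_imp_le_base) simp
      moreover have "cmod (x (N k)) / root (Suc k) M \<le> cmod (x (N k))"
        using rootM[of k] by (simp add: divide_le_eq mult_le_cancel_left1)
      ultimately show ?thesis
        unfolding p_norm by (rule order_trans[rotated])
    qed
    then show "\<forall>\<^sub>F k in sequentially. norm (p k x) \<le> 1 / real (Suc k)"
      by simp
    show "(\<lambda>k. 1 / real (Suc k)) \<longlonglongrightarrow> 0"
      by (rule LIMSEQ_Suc[OF lim_1_over_n])
  qed
  moreover have "(\<lambda>k. cmod (p k y)) \<longlonglongrightarrow> 1"
  proof (rule tendsto_sandwich)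
    have "root (Suc k) (c / M) \<le> cmod (p k y)" for k
    proof -
      have "a \<le> cmod (y i - dense_seq (l k)) + dist (dense_seq (l k)) (x i)"
        using norm_triangle_ineq[of "y i - dense_seq (l k)" "dense_seq (l k) - x i"]
        by (simp add: a_def dist_norm)
      then have "a / 2 \<le> cmod (y i - dense_seq (l k))"
        using l[of k] by (simp add: e_def)
      then have "c \<le> cmod (y (N k)) ^ Suc k"
        unfolding pow[OF y] c_def by (intro mult_right_mono) auto
      then have "root (Suc k) c \<le> root (Suc k) (cmod (y (N k)) ^ Suc k)"
        by (subst real_root_le_iff) auto
      then have "root (Suc k) c \<le> cmod (y (N k))"
        by (subst (asm) real_root_power_cancel) auto
      then show ?thesis
        using rootM[of k] by (simp add: p_norm real_root_divide divide_right_mono)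
    qed
    then show "\<forall>\<^sub>F k in sequentially. root (Suc k) (c / M) \<le> cmod (p k y)"
      by simp
    show "\<forall>\<^sub>F k in sequentially. cmod (p k y) \<le> 1"
      using p1[OF y] by simp
    show "(\<lambda>k. root (Suc k) (c / M)) \<longlonglongrightarrow> 1"
      using c M by (intro LIMSEQ_Suc[OF LIMSEQ_root_const]) simp
  qed simp
  ultimately show ?thesis
    by (intro exI[of _ p]) blast
qed

section \<open>The uniform algebra generated by the coordinates\<close>

abbreviation root_top :: "(nat \<Rightarrow> complex) topology" where
  "root_top \<equiv> top_of_set root_space"

definition coordinate_algebra :: "((nat \<Rightarrow> complex) \<Rightarrow> complex) set" where
  "coordinate_algebra = {restrict p root_space | p n. cpoly n p}"

definition root_algebra :: "((nat \<Rightarrow> complex) \<Rightarrow> complex) set" where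
  "root_algebra = uniform_closure root_top coordinate_algebra"

lemma coordinate_algebraI: "cpoly n p \<Longrightarrow> restrict p root_space \<in> coordinate_algebra"
  by (auto simp: coordinate_algebra_def)

lemma compact_space_root_top: "compact_space root_top"
  using compact_root_space by (simp add: compact_space_subtopology)

lemma Hausdorff_space_root_top: "Hausdorff_space root_top"
  by (simp add: Hausdorff_space_subtopology)

lemma cfun_restrict:
  "cfun_add root_top (restrict p root_space) (restrict q root_space) = restrict (\<lambda>z. p z + q z) root_space"
  "cfun_mult root_top (restrict p root_space) (restrict q root_space) = restrict (\<lambda>z. p z * q z) root_space"
  "cfun_scale root_top c (restrict p root_space) = restrict (\<lambda>z. c * p z) root_space"
  "cfun_const root_top c = restrict (\<lambda>_. c) root_space"
  by (auto simp: cfun_add_def cfun_mult_def cfun_scale_def cfun_const_def)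

lemma function_algebra_coordinate_algebra: "function_algebra root_top coordinate_algebra"
  unfolding function_algebra_def
proof (intro conjI ballI allI subsetI)
  fix f assume "f \<in> coordinate_algebra"
  then obtain n p where p: "cpoly n p" "f = restrict p root_space"
    by (auto simp: coordinate_algebra_def)
  have "continuous_map root_top euclidean (restrict p root_space)"
    using continuous_on_cpoly[OF p(1), of root_space]
    by (auto intro: continuous_map_eq[of _ _ p])
  then show "f \<in> mspace (cfun_metric root_top)"
    by (auto simp: mspace_cfun_metric[OF compact_space_root_top] p(2))
next
  fix f g assume "f \<in> coordinate_algebra" "g \<in> coordinate_algebra"
  then obtain m n p q where pq: "cpoly m p" "f = restrict p root_space" "cpoly n q" "g = restrict q root_space"
    by (auto simp: coordinate_algebra_def)
  then have "cpoly (max m n) p" "cpoly (max m n) q"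
    by (auto intro: cpoly_mono)
  then show "cfun_add root_top f g \<in> coordinate_algebra" "cfun_mult root_top f g \<in> coordinate_algebra"
    unfolding pq cfun_restrict by (blast intro: coordinate_algebraI cpoly.add cpoly_mult)+
next
  fix c
  show "cfun_const root_top c \<in> coordinate_algebra"
    unfolding cfun_restrict by (rule coordinate_algebraI[OF cpoly_const])
qed

lemma coordinate_algebra_subset:
  "coordinate_algebra \<subseteq> mspace (cfun_metric root_top)" "coordinate_algebra \<subseteq> root_algebra"
  using function_algebra_coordinate_algebra subset_uniform_closure[OF compact_space_root_top]
  by (simp_all add: function_algebra_def root_algebra_def)

lemma uniform_algebra_root_algebra: "uniform_algebra root_top root_algebra"
  unfolding root_algebra_def
proof (rule uniform_algebra_uniform_closure[OF compact_space_root_top Hausdorff_space_root_top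
      function_algebra_coordinate_algebra])
  fix x y assume xy: "x \<in> topspace root_top" "y \<in> topspace root_top" "x \<noteq> y"
  then obtain i where "x i \<noteq> y i" by blast
  then show "\<exists>f\<in>coordinate_algebra. f x \<noteq> f y"
    using xy by (intro bexI[OF _ coordinate_algebraI[OF cpoly_coordinate[of i "Suc i"]]]) auto
qed

lemma restrict_cpoly_in_root_algebra: "cpoly n p \<Longrightarrow> restrict p root_space \<in> root_algebra"
  using coordinate_algebraI coordinate_algebra_subset(2) by blast

text \<open>The values of a character on the coordinate functions satisfy the defining equations, because
  these are algebraic, and the bound on the first coordinate, because characters have norm at most
  $1$.  So they form a point of the space, and the character agrees with evaluation there on
  polynomials, hence on their closure.\<close>

lemma character_is_evaluation:
  assumes phi: "\<phi> \<in> characters root_top root_algebra"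
  shows "\<exists>x\<in>root_space. \<forall>f\<in>root_algebra. \<phi> f = f x"
proof -
  note UA = uniform_algebra_root_algebra
  note inB = restrict_cpoly_in_root_algebra
  define x where "x n = \<phi> (restrict (\<lambda>z. z n) root_space)" for n
  have coord: "restrict (\<lambda>z. z n) root_space \<in> root_algebra" for n
    using inB[OF cpoly_coordinate[of n "Suc n"]] by simp
  have power: "\<phi> (restrict (\<lambda>z. z n ^ k) root_space) = x n ^ k" for n k
  proof (induction k)
    case 0
    show ?case
      using character_const[OF UA phi, of 1] by (simp only: cfun_restrict power_0)
  next
    case (Suc k)
    have "\<phi> (cfun_mult root_top (restrict (\<lambda>z. z n) root_space) (restrict (\<lambda>z. z n ^ k) root_space))
        = x n * x n ^ k"
      by (simp only: character_mult[OF phi coord inB[OF cpoly_power[OF cpoly_coordinate[OF lessI]]]] Suc.IH x_def)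
    then show ?case
      by (simp only: cfun_restrict power_Suc)
  qed
  have poly: "\<phi> (restrict p root_space) = p x" if "cpoly n p" for n p
    using that
  proof (induction rule: cpoly.induct)
    case (const0 c)
    show ?case
      using character_const[OF UA phi, of c] by (simp only: cfun_restrict)
  next
    case (monomial n a k)
    have "\<phi> (cfun_mult root_top (restrict a root_space) (restrict (\<lambda>z. z n ^ k) root_space)) = a x * x n ^ k"
      by (simp only: character_mult[OF phi inB[OF monomial.hyps] inB[OF cpoly_power[OF cpoly_coordinate[OF lessI]]]]
        monomial.IH power)
    then show ?case
      by (simp only: cfun_restrict)
  next
    case (add n p q)
    have "\<phi> (cfun_add root_top (restrict p root_space) (restrict q root_space)) = p x + q x"
      by (simp only: character_add[OF phi inB[OF add.hyps(1)] inB[OF add.hyps(2)]] add.IH)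
    then show ?case
      by (simp only: cfun_restrict)
  qed
  have "x \<in> root_space"
  proof -
    have "cmod (x 0) \<le> 1"
      unfolding x_def
      by (rule character_norm_le[OF UA phi coord]) (auto simp: root_space_def)
    moreover have "x (Suc k) ^ root_degree k = radicand k x" for k
    proof -
      have "restrict (\<lambda>z. z (Suc k) ^ root_degree k) root_space = restrict (radicand k) root_space"
        by (rule restrict_ext) (simp add: root_space_def)
      then show ?thesis
        using poly[OF cpoly_radicand[of k]] power[of "Suc k" "root_degree k"] by simp
    qed
    ultimately show ?thesis
      by (simp add: root_space_def)
  qed
  moreover have "\<phi> f = f x" if f: "f \<in> root_algebra" for f
  proof -
    obtain a where a: "\<And>k. a k \<in> coordinate_algebra" "uniform_limit root_space a f sequentially"
      using f unfolding root_algebra_def uniform_closure_iff[OF compact_space_root_top coordinate_algebra_subset(1)]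
      by auto
    have aB: "a k \<in> root_algebra" for k
      using a(1) coordinate_algebra_subset(2) by blast
    have phi_a: "\<phi> (a k) = a k x" for k
    proof -
      obtain n p where "cpoly n p" "a k = restrict p root_space"
        using a(1)[of k] by (auto simp: coordinate_algebra_def)
      then show ?thesis
        using poly \<open>x \<in> root_space\<close> by simp
    qed
    have "(\<lambda>k. \<phi> (a k)) \<longlonglongrightarrow> \<phi> f"
    proof (rule metric_LIMSEQ_I)
      fix e :: real assume e: "e > 0"
      then have "\<forall>\<^sub>F k in sequentially. \<forall>z\<in>root_space. dist (a k z) (f z) < e / 2"
        by (intro uniform_limitD[OF a(2)]) simp
      then obtain M where M: "\<And>k z. k \<ge> M \<Longrightarrow> z \<in> root_space \<Longrightarrow> dist (a k z) (f z) < e / 2"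
        by (auto simp: eventually_sequentially)
      have "dist (\<phi> (a k)) (\<phi> f) < e" if "k \<ge> M" for k
      proof -
        have sc: "cfun_scale root_top (-1) f \<in> root_algebra"
          using UA f by (simp add: uniform_algebra_def)
        then have "cfun_add root_top (a k) (cfun_scale root_top (-1) f) \<in> root_algebra"
          using UA aB by (simp add: uniform_algebra_def)
        then have "cmod (\<phi> (cfun_add root_top (a k) (cfun_scale root_top (-1) f))) \<le> e / 2"
          using M[OF that] e
          by (intro character_norm_le[OF UA phi])
             (auto simp: cfun_add_def cfun_scale_def dist_norm intro: less_imp_le)
        then show ?thesis
          using e by (simp add: character_add[OF phi aB sc] character_scale[OF phi f] dist_norm)
      qed
      then show "\<exists>M. \<forall>k\<ge>M. dist (\<phi> (a k)) (\<phi> f) < e"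
        by blast
    qed
    moreover have "(\<lambda>k. \<phi> (a k)) \<longlonglongrightarrow> f x"
      unfolding phi_a by (rule tendsto_uniform_limitI[OF a(2) \<open>x \<in> root_space\<close>])
    ultimately show ?thesis
      by (rule LIMSEQ_unique)
  qed
  ultimately show ?thesis by blast
qed

lemma dual_norm_commute:
  "dual_norm X B (\<lambda>f\<in>B. \<phi> f - \<psi> f) = dual_norm X B (\<lambda>f\<in>B. \<psi> f - \<phi> f)"
  unfolding dual_norm_def by (intro SUP_cong) (auto simp: norm_minus_commute)

text \<open>At most one of two distinct points is the origin, so one of them has a nonzero coordinate;
  \<open>separating_sequence\<close> applies with that point in the second place.\<close>

lemma root_algebra_parts_trivial:
  assumes phi: "\<phi> \<in> characters root_top root_algebra" and psi: "\<psi> \<in> characters root_top root_algebra"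
    and ne: "\<phi> \<noteq> \<psi>"
  shows "2 \<le> dual_norm root_top root_algebra (\<lambda>f\<in>root_algebra. \<phi> f - \<psi> f)"
proof -
  obtain x where x: "x \<in> root_space" "\<And>f. f \<in> root_algebra \<Longrightarrow> \<phi> f = f x"
    using character_is_evaluation[OF phi] by blast
  obtain y where y: "y \<in> root_space" "\<And>f. f \<in> root_algebra \<Longrightarrow> \<psi> f = f y"
    using character_is_evaluation[OF psi] by blast
  have "x \<noteq> y"
  proof
    assume "x = y"
    then have "\<phi> = \<psi>"
      using phi psi x(2) y(2)
      by (intro extensionalityI[of \<phi> root_algebra]) (auto simp: characters_def linear_functional_def)
    with ne show False by simp
  qed
  have *: "2 \<le> dual_norm root_top root_algebra (\<lambda>f\<in>root_algebra. \<eta> f - \<theta> f)"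
    if char: "\<eta> \<in> characters root_top root_algebra" "\<theta> \<in> characters root_top root_algebra"
      and u: "u \<in> root_space" "\<And>f. f \<in> root_algebra \<Longrightarrow> \<eta> f = f u"
      and v: "v \<in> root_space" "\<And>f. f \<in> root_algebra \<Longrightarrow> \<theta> f = f v"
      and uv: "u \<noteq> v" "v j \<noteq> 0" for \<eta> \<theta> u v j
  proof -
    obtain p where p: "\<And>k. \<exists>n. cpoly n (p k)" "\<And>k z. z \<in> root_space \<Longrightarrow> cmod (p k z) \<le> 1"
      "(\<lambda>k. p k u) \<longlonglongrightarrow> 0" "(\<lambda>k. cmod (p k v)) \<longlonglongrightarrow> 1"
      using separating_sequence[OF u(1) v(1) uv] by blast
    have pB: "restrict (p k) root_space \<in> root_algebra" for k
      using p(1)[of k] restrict_cpoly_in_root_algebra by blast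
    show ?thesis
      by (rule dual_norm_ge_2[OF uniform_algebra_root_algebra char pB])
         (use p u v pB in auto)
  qed
  show ?thesis
  proof (cases "\<exists>j. y j \<noteq> 0")
    case True
    then show ?thesis
      using *[OF phi psi x y \<open>x \<noteq> y\<close>] by blast
  next
    case False
    with \<open>x \<noteq> y\<close> obtain j where "x j \<noteq> 0"
      by fastforce
    then show ?thesis
      using *[OF psi phi y x \<open>x \<noteq> y\<close>[symmetric]] by (subst dual_norm_commute) blast
  qed
qed

text \<open>The derivative along the axis is defined on polynomials in the ambient space, although the axis
  leaves the space itself beyond the origin.  The bound \<open>axis_deriv_le\<close> makes it depend only
  on the restriction to the space.\<close>

lemma root_algebra_point_derivation:
  "\<exists>\<psi>. bounded_point_derivation root_top root_algebra (\<lambda>f\<in>root_algebra. f (axis_point 0)) \<psi> \<and>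
       \<psi> (\<lambda>z\<in>root_space. z 0) = 1"
proof -
  define \<delta> where "\<delta> f = axis_deriv (SOME p. (\<exists>n. cpoly n p) \<and> f = restrict p root_space)" for f
  have \<delta>: "\<delta> (restrict p root_space) = axis_deriv p" if p: "cpoly n p" for n p
  proof -
    define q where "q = (SOME q. (\<exists>n. cpoly n q) \<and> restrict p root_space = restrict q root_space)"
    have "\<exists>q. (\<exists>n. cpoly n q) \<and> restrict p root_space = restrict q root_space"
      using p by blast
    then have "(\<exists>n. cpoly n q) \<and> restrict p root_space = restrict q root_space"
      unfolding q_def by (rule someI_ex)
    then obtain m where q: "cpoly m q" and eq: "restrict p root_space = restrict q root_space"
      by blast
    have pq: "cpoly (max m n) p" "cpoly (max m n) q"
      using p q by (auto intro: cpoly_mono)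
    have "p z = q z" if "z \<in> root_space" for z
      using fun_cong[OF eq, of z] that by simp
    then have "cmod (axis_deriv (\<lambda>z. p z - q z)) \<le> 0"
      by (intro axis_deriv_le[OF cpoly_diff[OF pq]]) simp
    then have "axis_deriv p = axis_deriv q"
      by (simp add: axis_deriv_diff[OF pq])
    then show ?thesis
      by (simp only: \<delta>_def q_def)
  qed
  have rep: "\<exists>n p. cpoly n p \<and> f = restrict p root_space" if "f \<in> coordinate_algebra" for f
    using that by (auto simp: coordinate_algebra_def)
  have rep2: "\<exists>n p q. cpoly n p \<and> cpoly n q \<and> f = restrict p root_space \<and> g = restrict q root_space"
    if fg: "f \<in> coordinate_algebra" "g \<in> coordinate_algebra" for f g
  proof -
    obtain m n p q where "cpoly m p" "f = restrict p root_space" "cpoly n q" "g = restrict q root_space"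
      using rep fg by metis
    then show ?thesis
      by (intro exI[of _ "max m n"] exI[of _ p] exI[of _ q]) (auto intro: cpoly_mono)
  qed
  have "\<exists>\<psi>. bounded_point_derivation root_top root_algebra (\<lambda>f\<in>root_algebra. f (axis_point 0)) \<psi> \<and>
          (\<forall>f\<in>coordinate_algebra. \<psi> f = \<delta> f)"
    unfolding root_algebra_def
  proof (rule extend_point_derivation[OF compact_space_root_top function_algebra_coordinate_algebra])
    fix f g assume "f \<in> coordinate_algebra" "g \<in> coordinate_algebra"
    then obtain n p q where p: "cpoly n p" and q: "cpoly n q"
        and fg: "f = restrict p root_space" "g = restrict q root_space"
      using rep2 by blast
    show "\<delta> (cfun_add root_top f g) = \<delta> f + \<delta> g"
      unfolding fg cfun_restrict by (simp add: \<delta>[OF cpoly.add[OF p q]] \<delta>[OF p] \<delta>[OF q] axis_deriv_add[OF p q])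
    show "\<delta> (cfun_mult root_top f g) = \<delta> f * g (axis_point 0) + f (axis_point 0) * \<delta> g"
      unfolding fg cfun_restrict
      by (simp add: \<delta>[OF cpoly_mult[OF p q]] \<delta>[OF p] \<delta>[OF q] axis_deriv_mult[OF p q] origin_in_root_space)
  next
    fix c f assume "f \<in> coordinate_algebra"
    then obtain n p where p: "cpoly n p" and f: "f = restrict p root_space"
      using rep by blast
    show "\<delta> (cfun_scale root_top c f) = c * \<delta> f"
      unfolding f cfun_restrict by (simp add: \<delta>[OF cpoly_cmult[OF p]] \<delta>[OF p] axis_deriv_cmult[OF p])
  next
    fix f c assume fA: "f \<in> coordinate_algebra" and le: "\<And>y. y \<in> topspace root_top \<Longrightarrow> cmod (f y) \<le> c"
    then obtain n p where p: "cpoly n p" and f: "f = restrict p root_space"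
      using rep by blast
    show "cmod (\<delta> f) \<le> c"
      unfolding f \<delta>[OF p] using le by (intro axis_deriv_le[OF p]) (auto simp: f)
  qed (simp add: origin_in_root_space)
  moreover have z0: "cpoly (Suc 0) (\<lambda>z. z 0)"
    by (rule cpoly_coordinate) simp
  moreover have "\<delta> (\<lambda>z\<in>root_space. z 0) = 1"
    unfolding \<delta>[OF z0] axis_deriv_coordinate by simp
  ultimately show ?thesis
    using coordinate_algebraI[OF z0] by auto
qed

theorem theorem1p1:
  shows "\<exists>(X :: (nat \<Rightarrow> complex) topology) B.
    compact_space X \<and> metrizable_space X \<and> Hausdorff_space X \<and>
    uniform_algebra X B \<and>
    (\<exists>\<phi> \<in> topspace (maximal_ideal_space X B). \<exists>\<psi>.
       bounded_point_derivation X B \<phi> \<psi> \<and> (\<exists>f\<in>B. \<psi> f \<noteq> 0)) \<and>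
    \<not> (\<exists>P \<in> gleason_parts X B. nontrivial_part P)"
proof (intro exI conjI)
  show "compact_space root_top" "Hausdorff_space root_top" "uniform_algebra root_top root_algebra"
    by (fact compact_space_root_top Hausdorff_space_root_top uniform_algebra_root_algebra)+
  show "metrizable_space root_top"
    by (intro metrizable_space_subtopology metrizable_space_euclidean)
  show "\<not> (\<exists>P \<in> gleason_parts root_top root_algebra. nontrivial_part P)"
    by (rule no_nontrivial_part) (rule root_algebra_parts_trivial)
  obtain \<psi> where psi:
      "bounded_point_derivation root_top root_algebra (\<lambda>f\<in>root_algebra. f (axis_point 0)) \<psi>"
      "\<psi> (\<lambda>z\<in>root_space. z 0) = 1"
    using root_algebra_point_derivation by blast
  have "(\<lambda>z\<in>root_space. z 0) \<in> root_algebra"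
    using restrict_cpoly_in_root_algebra[OF cpoly_coordinate[of 0 "Suc 0"]] by simp
  moreover have "(\<lambda>f\<in>root_algebra. f (axis_point 0)) \<in> topspace (maximal_ideal_space root_top root_algebra)"
    unfolding topspace_maximal_ideal_space
    by (rule evaluation_character[OF uniform_algebra_root_algebra]) (simp add: origin_in_root_space)
  ultimately show "\<exists>\<phi>\<in>topspace (maximal_ideal_space root_top root_algebra). \<exists>\<psi>.
      bounded_point_derivation root_top root_algebra \<phi> \<psi> \<and> (\<exists>f\<in>root_algebra. \<psi> f \<noteq> 0)"
    using psi by (intro bexI[of _ "\<lambda>f\<in>root_algebra. f (axis_point 0)"] exI[of _ \<psi>] conjI
        bexI[of _ "\<lambda>z\<in>root_space. z 0"]) simp_all
qed

end
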